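(* Assume (B1), (B2) and (B3). For $0\le s\le t$, let $$\mathsf{A}(s,t)=\{\eta\in\mathsf{C}(\mathbb{R}_+,\mathsf{X}):\eta(u)\in\mathsf{O}\text{ for all }u\in[s,t]\}.$$ Then for any $0\le s\le t$, any $x\in\mathsf{X}$ and any $\beta$-fluid limit $\mathbb{Q}^\beta_x$, on $\mathsf{A}(s,t)$, $$\sup_{s\le u\le t}\Big|\eta(u)-\eta(s)-\int_s^u h(\eta(v))\,dv\Big|=0\qquad\mathbb{Q}^\beta_x\text{-a.s.},$$ where $h(y)=|y|^{-\beta}\Delta_\infty(y)$ for $y\in\mathsf{O}$.
   Context: $\mathsf{X}$ is a $d$-dimensional Euclidean space with norm $|\cdot|$ and Borel $\sigma$-field. $\{\Phi_k\}_{k\ge0}$ is a Markov chain on $\mathsf{X}$ with natural filtration $\{\mathcal{F}_k\}$; $\mathbb{P}_x,\mathbb{E}_x$ denote law and expectation of the chain given $\Phi_0=x$. It is assumed that $\mathbb{E}_x|\Phi_1|<\infty$ for all $x$. Put $\Delta(x)=\mathbb{E}_x[\Phi_1]-x$ and $\epsilon_k=\Phi_k-\mathbb{E}[\Phi_k\mid\mathcal{F}_{k-1}]$, $k\ge1$. (B1) There exists $p>1$ such that $\lim_{K\to\infty}\sup_{x\in\mathsf{X}}\mathbb{E}_x\big[|\epsilon_1|^p\mathbf{1}\{|\epsilon_1|\ge K\}\big]=0$. (B2) There exists $\beta\in[0,1\wedge(p-1))$ such that $N(\beta,\Delta)=\sup_{x\in\mathsf{X}}\{(1+|x|^\beta)|\Delta(x)|\}<\infty$.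 (B3) There exist an open cone $\mathsf{O}\subseteq\mathsf{X}\setminus\{0\}$ and a continuous function $\Delta_\infty:\mathsf{O}\to\mathsf{X}$ such that, for any compact $\mathsf{H}\subseteq\mathsf{O}$, $\lim_{r\to+\infty}\sup_{x\in\mathsf{H}}\big|r^\beta|x|^\beta\Delta(rx)-\Delta_\infty(x)\big|=0$, with $\beta$ from (B2). $\mathsf{C}(\mathbb{R}_+,\mathsf{X})$: continuous functions (local uniform topology); $\mathsf{D}(\mathbb{R}_+,\mathsf{X})$: càdlàg functions (Skorokhod topology). For $r>0$, $x\in\mathsf{X}$, let $\eta^\beta_r(t;x)=r^{-1}\Phi_{\lfloor tr^{1+\beta}\rfloor}$ where $\Phi_0=rx$, and let $\mathbb{Q}^\beta_{r;x}$ be the law on $\mathsf{D}(\mathbb{R}_+,\mathsf{X})$ of $\eta^\beta_r(\cdot;x)$ under $\mathbb{P}_{rx}$. A probability measure $\mathbb{Q}^\beta_x$ is a $\beta$-fluid limit (with initial point $x$) if there exist $r_n\to+\infty$, $x_n\to x$ with $\mathbb{Q}^\beta_{r_n;x_n}\Rightarrow\mathbb{Q}^\beta_x$ weakly; under (B1)–(B2) every $\beta$-fluid limit is carried by $\mathsf{C}(\mathbb{R}_+,\mathsf{X})$. $\eta$ denotes the canonical path. *)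

theory Defs
  imports "HOL-Probability.Probability"
begin

section \<open>Markov chains on a Euclidean space\<close>

definition natural_filtration ::
  "'w measure \<Rightarrow> (nat \<Rightarrow> 'w \<Rightarrow> 'a::topological_space) \<Rightarrow> nat \<Rightarrow> 'w measure" where
  "natural_filtration M \<Phi> k =
     sigma (space M) {\<Phi> j -` A \<inter> space M | j A. j \<le> k \<and> A \<in> sets borel}"

text \<open>
  A time-homogeneous Markov chain with transition kernel \<open>P\<close>, given as one process \<open>\<Phi>\<close> on a
  measurable space \<open>\<Omega>\<close> carrying the laws \<open>Pr x\<close>, the law of the chain started at \<open>x\<close>.  The last
  clause is the Markov property with respect to the natural filtration.
\<close>

definition markov_chain ::
  "('a::euclidean_space \<Rightarrow> 'a measure) \<Rightarrow> 'w measure \<Rightarrow> ('a \<Rightarrow> 'w measure) \<Rightarrow> (nat \<Rightarrow> 'w \<Rightarrow> 'a) \<Rightarrow> bool"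
where
  "markov_chain P \<Omega> Pr \<Phi> \<longleftrightarrow>
     P \<in> borel \<rightarrow>\<^sub>M prob_algebra borel \<and>
     (\<forall>k. \<Phi> k \<in> \<Omega> \<rightarrow>\<^sub>M borel) \<and>
     (\<forall>x. prob_space (Pr x) \<and> sets (Pr x) = sets \<Omega> \<and>
        (AE \<omega> in Pr x. \<Phi> 0 \<omega> = x) \<and>
        (\<forall>k. \<forall>A\<in>sets borel. AE \<omega> in Pr x.
           real_cond_exp (Pr x) (natural_filtration (Pr x) \<Phi> k)
             (indicator (\<Phi> (Suc k) -` A \<inter> space (Pr x))) \<omega> = measure (P (\<Phi> k \<omega>)) A))"

definition drift :: "('a::euclidean_space \<Rightarrow> 'w measure) \<Rightarrow> (nat \<Rightarrow> 'w \<Rightarrow> 'a) \<Rightarrow> 'a \<Rightarrow> 'a" where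
  "drift Pr \<Phi> x = (\<integral>\<omega>. \<Phi> 1 \<omega> \<partial>Pr x) - x"

text \<open>
  The library has conditional expectations of real random variables only; for vectors the
  conditional expectation is taken coordinatewise.
\<close>

definition vec_cond_exp ::
  "'w measure \<Rightarrow> 'w measure \<Rightarrow> ('w \<Rightarrow> 'a::euclidean_space) \<Rightarrow> 'w \<Rightarrow> 'a" where
  "vec_cond_exp M F f \<omega> = (\<Sum>b\<in>Basis. real_cond_exp M F (\<lambda>\<omega>'. f \<omega>' \<bullet> b) \<omega> *\<^sub>R b)"

text \<open>Meaningful for \<open>k \<ge> 1\<close> only.\<close>

definition innovation ::
  "'w measure \<Rightarrow> (nat \<Rightarrow> 'w \<Rightarrow> 'a::euclidean_space) \<Rightarrow> nat \<Rightarrow> 'w \<Rightarrow> 'a" where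
  "innovation M \<Phi> k \<omega> = \<Phi> k \<omega> - vec_cond_exp M (natural_filtration M \<Phi> (k - 1)) (\<Phi> k) \<omega>"


section \<open>The assumptions on the chain\<close>

text \<open>
  Suprema are taken in \<^typ>\<open>ennreal\<close>, so that they are meaningful without boundedness side
  conditions and equal \<open>0\<close> over the empty set.
\<close>

definition cond_B1 ::
  "('a::euclidean_space \<Rightarrow> 'w measure) \<Rightarrow> (nat \<Rightarrow> 'w \<Rightarrow> 'a) \<Rightarrow> real \<Rightarrow> bool" where
  "cond_B1 Pr \<Phi> p \<longleftrightarrow> p > 1 \<and>
     ((\<lambda>K::real. \<Squnion>x. \<integral>\<^sup>+\<omega>. ennreal (norm (innovation (Pr x) \<Phi> 1 \<omega>) powr p) *
          indicator {\<omega>. norm (innovation (Pr x) \<Phi> 1 \<omega>) \<ge> K} \<omega> \<partial>Pr x) \<longlongrightarrow> 0) at_top"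

text \<open>
  Note \<^prop>\<open>(0::real) powr 0 = 0\<close>: for \<open>\<beta> = 0\<close> the factor at \<open>x = 0\<close> is \<open>1\<close> here instead of \<open>2\<close>,
  which does not affect the finiteness of the supremum.
\<close>

definition drift_bound :: "real \<Rightarrow> ('a::euclidean_space \<Rightarrow> 'a) \<Rightarrow> ennreal" where
  "drift_bound \<beta> \<Delta> = (\<Squnion>x. ennreal ((1 + norm x powr \<beta>) * norm (\<Delta> x)))"

definition cond_B2 ::
  "('a::euclidean_space \<Rightarrow> 'w measure) \<Rightarrow> (nat \<Rightarrow> 'w \<Rightarrow> 'a) \<Rightarrow> real \<Rightarrow> real \<Rightarrow> bool" where
  "cond_B2 Pr \<Phi> p \<beta> \<longleftrightarrow> 0 \<le> \<beta> \<and> \<beta> < min 1 (p - 1) \<and> drift_bound \<beta> (drift Pr \<Phi>) < \<infinity>"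

text \<open>
  Cones are closed under multiplication by positive scalars.  The library predicates
  \<^const>\<open>cone\<close> and \<^const>\<open>conic\<close> also allow the scalar \<open>0\<close> and would force \<open>0 \<in> \<O>\<close>.
\<close>

definition cond_B3 ::
  "('a::euclidean_space \<Rightarrow> 'w measure) \<Rightarrow> (nat \<Rightarrow> 'w \<Rightarrow> 'a) \<Rightarrow> real \<Rightarrow> 'a set \<Rightarrow> ('a \<Rightarrow> 'a) \<Rightarrow> bool" where
  "cond_B3 Pr \<Phi> \<beta> \<O> \<Delta>\<^sub>i\<^sub>n\<^sub>f \<longleftrightarrow>
     open \<O> \<and> (\<forall>x\<in>\<O>. \<forall>c>0. c *\<^sub>R x \<in> \<O>) \<and> \<O> \<subseteq> - {0} \<and> continuous_on \<O> \<Delta>\<^sub>i\<^sub>n\<^sub>f \<and>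
     (\<forall>H. compact H \<and> H \<subseteq> \<O> \<longrightarrow>
        ((\<lambda>r::real. \<Squnion>x\<in>H. ennreal (norm
            ((r powr \<beta> * norm x powr \<beta>) *\<^sub>R drift Pr \<Phi> (r *\<^sub>R x) - \<Delta>\<^sub>i\<^sub>n\<^sub>f x))) \<longlongrightarrow> 0) at_top)"


section \<open>Path spaces and the Skorokhod topology\<close>

text \<open>Functions on the nonnegative half-line are represented as extensional functions on \<open>{0..}\<close>.\<close>

definition continuous_paths :: "(real \<Rightarrow> 'a::metric_space) set" where
  "continuous_paths = {f \<in> extensional {0..}. continuous_on {0..} f}"

definition cadlag_paths :: "(real \<Rightarrow> 'a::metric_space) set" where
  "cadlag_paths = {f \<in> extensional {0..}.
     (\<forall>t\<ge>0. (f \<longlongrightarrow> f t) (at_right t)) \<and> (\<forall>t>0. \<exists>l. (f \<longlongrightarrow> l) (at_left t))}"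

text \<open>Increasing bijections of the half-line; continuity and \<open>\<theta> 0 = 0\<close> are automatic.\<close>

definition time_changes :: "(real \<Rightarrow> real) set" where
  "time_changes = {\<theta>. strict_mono_on {0..} \<theta> \<and> \<theta> ` {0..} = {0..}}"

definition skorokhod_converges :: "(nat \<Rightarrow> real \<Rightarrow> 'a::metric_space) \<Rightarrow> (real \<Rightarrow> 'a) \<Rightarrow> bool" where
  "skorokhod_converges f g \<longleftrightarrow> (\<exists>\<theta>. (\<forall>n. \<theta> n \<in> time_changes) \<and>
     uniform_limit {0..} \<theta> (\<lambda>t. t) sequentially \<and>
     (\<forall>T. uniform_limit {0..T} (\<lambda>n t. f n (\<theta> n t)) g sequentially))"

text \<open>
  The Skorokhod (J1) topology is the unique metrizable topology on the cadlag paths whose convergent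
  sequences are those given by \<^const>\<open>skorokhod_converges\<close> (Jacod and Shiryaev, Limit Theorems for
  Stochastic Processes, VI.1.14).  A metrizable topology is sequential, so its open sets are exactly
  the sequentially open ones.
\<close>

definition skorokhod_open :: "(real \<Rightarrow> 'a::metric_space) set \<Rightarrow> bool" where
  "skorokhod_open U \<longleftrightarrow> U \<subseteq> cadlag_paths \<and>
     (\<forall>g\<in>U. \<forall>f. (\<forall>n. f n \<in> cadlag_paths) \<longrightarrow> skorokhod_converges f g \<longrightarrow>
        (\<forall>\<^sub>F n in sequentially. f n \<in> U))"

definition skorokhod_topology :: "(real \<Rightarrow> 'a::metric_space) topology" where
  "skorokhod_topology = topology skorokhod_open"

lemma istopology_skorokhod_open: "istopology skorokhod_open"
  unfolding istopology_def
proof (intro conjI allI impI)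
  fix S T :: "(real \<Rightarrow> 'a) set"
  assume "skorokhod_open S" "skorokhod_open T"
  then show "skorokhod_open (S \<inter> T)"
    unfolding skorokhod_open_def by (auto simp: eventually_conj_iff)
next
  fix \<U> :: "(real \<Rightarrow> 'a) set set"
  assume *: "\<forall>U\<in>\<U>. skorokhod_open U"
  show "skorokhod_open (\<Union>\<U>)"
    unfolding skorokhod_open_def
  proof (intro conjI ballI allI impI)
    show "\<Union>\<U> \<subseteq> cadlag_paths" using * unfolding skorokhod_open_def by blast
  next
    fix g f assume g: "g \<in> \<Union>\<U>" and f: "\<forall>n. f n \<in> cadlag_paths" "skorokhod_converges f g"
    from g obtain U where U: "U \<in> \<U>" "g \<in> U" by blast
    with * f have "\<forall>\<^sub>F n in sequentially. f n \<in> U" unfolding skorokhod_open_def by blast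
    then show "\<forall>\<^sub>F n in sequentially. f n \<in> \<Union>\<U>"
      by eventually_elim (use U in blast)
  qed
qed

lemma openin_skorokhod_topology: "openin skorokhod_topology U \<longleftrightarrow> skorokhod_open U"
  by (simp add: skorokhod_topology_def istopology_skorokhod_open)

lemma topspace_skorokhod_topology: "topspace skorokhod_topology = cadlag_paths"
proof -
  have "skorokhod_open cadlag_paths" by (simp add: skorokhod_open_def)
  moreover have "U \<subseteq> cadlag_paths" if "skorokhod_open U" for U :: "(real \<Rightarrow> 'a) set"
    using that by (simp add: skorokhod_open_def)
  ultimately show ?thesis
    unfolding topspace_def openin_skorokhod_topology by blast
qed

definition borel_of_topology :: "'b topology \<Rightarrow> 'b measure" where
  "borel_of_topology X = sigma (topspace X) {U. openin X U}"

definition weakly_converges :: "'b topology \<Rightarrow> (nat \<Rightarrow> 'b measure) \<Rightarrow> 'b measure \<Rightarrow> bool" where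
  "weakly_converges X Q Q' \<longleftrightarrow>
     (\<forall>g::'b \<Rightarrow> real. continuous_map X euclideanreal g \<and> bounded (g ` topspace X) \<longrightarrow>
        (\<lambda>n. \<integral>\<eta>. g \<eta> \<partial>Q n) \<longlonglongrightarrow> (\<integral>\<eta>. g \<eta> \<partial>Q'))"


section \<open>Fluid limits\<close>

definition scaled_path ::
  "(nat \<Rightarrow> 'w \<Rightarrow> 'a::euclidean_space) \<Rightarrow> real \<Rightarrow> real \<Rightarrow> 'w \<Rightarrow> real \<Rightarrow> 'a" where
  "scaled_path \<Phi> \<beta> r \<omega> = (\<lambda>t\<in>{0..}. (1 / r) *\<^sub>R \<Phi> (nat \<lfloor>t * r powr (1 + \<beta>)\<rfloor>) \<omega>)"

definition scaled_law ::
  "('a::euclidean_space \<Rightarrow> 'w measure) \<Rightarrow> (nat \<Rightarrow> 'w \<Rightarrow> 'a) \<Rightarrow> real \<Rightarrow> real \<Rightarrow> 'a \<Rightarrow> (real \<Rightarrow> 'a) measure" where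
  "scaled_law Pr \<Phi> \<beta> r x =
     distr (Pr (r *\<^sub>R x)) (borel_of_topology skorokhod_topology) (scaled_path \<Phi> \<beta> r)"

definition fluid_limit ::
  "('a::euclidean_space \<Rightarrow> 'w measure) \<Rightarrow> (nat \<Rightarrow> 'w \<Rightarrow> 'a) \<Rightarrow> real \<Rightarrow> 'a \<Rightarrow> (real \<Rightarrow> 'a) measure \<Rightarrow> bool" where
  "fluid_limit Pr \<Phi> \<beta> x Q \<longleftrightarrow>
     prob_space Q \<and> sets Q = sets (borel_of_topology skorokhod_topology) \<and>
     (\<exists>r y. (\<forall>n. 0 < r n) \<and> filterlim r at_top sequentially \<and> y \<longlonglongrightarrow> x \<and>
        weakly_converges skorokhod_topology (\<lambda>n. scaled_law Pr \<Phi> \<beta> (r n) (y n)) Q)"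

definition paths_in :: "'a::euclidean_space set \<Rightarrow> real \<Rightarrow> real \<Rightarrow> (real \<Rightarrow> 'a) set" where
  "paths_in \<O> s t = {\<eta> \<in> continuous_paths. \<forall>u\<in>{s..t}. \<eta> u \<in> \<O>}"

definition fluid_field :: "real \<Rightarrow> ('a::euclidean_space \<Rightarrow> 'a) \<Rightarrow> 'a \<Rightarrow> 'a" where
  "fluid_field \<beta> \<Delta>\<^sub>i\<^sub>n\<^sub>f y = norm y powr (- \<beta>) *\<^sub>R \<Delta>\<^sub>i\<^sub>n\<^sub>f y"

end

theory Submission
  imports Defs
begin

text \<open>
  The coordinates of a path are reached through the \<open>C\<^sup>1\<^sup>,\<^sup>1\<close> test functions
  \<open>f y = (max 0 (\<rho>\<^sup>2 - \<bar>y - c\<bar>\<^sup>2))\<^sup>2\<close>, supported in balls \<open>cball c \<rho> \<subseteq> \<O>\<close>.  Since the gradient of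
  \<open>f\<close> vanishes outside a compact subset of \<open>\<O>\<close>, the generator of the rescaled chain applied to \<open>f\<close>
  converges to \<open>g = \<nabla>f \<bullet> h\<close> uniformly on the whole space by (B3), with no localization in time.  As
  \<open>f\<close> is bounded, the martingale part of \<open>f\<close> along the rescaled chain has orthogonal square
  integrable increments, and its variance over a bounded time horizon is at most a constant times
  \<open>r\<^sup>1\<^sup>+\<^sup>\<beta>\<^sup>-\<^sup>q\<close> with \<open>q = min p 2 > 1 + \<beta>\<close>, so it vanishes.  The functional
  \<open>J \<eta> = \<integral>\<^sub>0\<^sup>T \<bar>f (\<eta> v) - f (\<eta> 0) - \<integral>\<^sub>0\<^sup>v g (\<eta> w) dw\<bar> dv\<close> is bounded and Skorokhod continuous, hence its
  expectation under a fluid limit is \<open>0\<close>.  On continuous paths \<open>J \<eta> = 0\<close> for all \<open>T\<close> gives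
  \<open>(f \<circ> \<eta>)' = g \<circ> \<eta>\<close>; near a point of \<open>\<O>\<close> this determines the derivative of \<open>\<bar>\<eta> - c\<bar>\<^sup>2\<close>, and the
  difference for two centres \<open>c\<close>, \<open>c + q b\<close> that of the coordinate \<open>\<eta> \<bullet> b\<close>.
\<close>

section \<open>Right-continuous paths and Skorokhod convergence\<close>

text \<open>Fix \<open>e\<close>. By right continuity, every point near which \<open>g\<close>
  oscillates by at least \<open>e\<close> owns an interval to its right on which \<open>g\<close>
  stays within \<open>e / 2\<close> of its value at that point. No second such point lies inside, so
  these intervals are disjoint and contain distinct rationals. The values
  \<open>e = 1 / Suc n\<close> exhaust all discontinuities.\<close>

lemma right_continuous_discontinuities_countable:
  fixes g :: "real \<Rightarrow> 'a::metric_space"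
  assumes rc: "\<And>t. a < t \<Longrightarrow> (g \<longlongrightarrow> g t) (at_right t)"
  shows "countable {t. a < t \<and> \<not> isCont g t}"
proof -
  define D where "D e = {t. a < t \<and> (\<forall>\<delta>>0. \<exists>u. dist u t < \<delta> \<and> dist (g u) (g t) \<ge> e)}" for e :: real
  have "countable (D e)" if e: "e > 0" for e
  proof -
    have "\<exists>b>t. \<forall>u. t < u \<and> u < b \<longrightarrow> dist (g u) (g t) < e / 2" if "t \<in> D e" for t
    proof -
      have "a < t" using that by (simp add: D_def)
      from tendstoD[OF rc[OF this], of "e / 2"] e show ?thesis
        by (auto simp: eventually_at_right_field)
    qed
    then obtain b where b: "\<And>t. t \<in> D e \<Longrightarrow> t < b t"
      and gb: "\<And>t u. t \<in> D e \<Longrightarrow> t < u \<Longrightarrow> u < b t \<Longrightarrow> dist (g u) (g t) < e / 2"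
      by metis
    have sep: "b t \<le> t'" if t: "t \<in> D e" "t' \<in> D e" "t < t'" for t t'
    proof (rule ccontr)
      assume "\<not> b t \<le> t'"
      then have "min (t' - t) (b t - t') > 0" using t by simp
      then obtain u where u: "dist u t' < min (t' - t) (b t - t')" "dist (g u) (g t') \<ge> e"
        using t(2) unfolding D_def by blast
      \<comment> \<open>Both \<open>u\<close> and \<open>t'\<close> lie between \<open>t\<close> and
        \<open>b t\<close>, so \<open>g\<close> differs by less than \<open>e\<close> at these two
        points, against the choice of \<open>u\<close>.\<close>
      have "dist (g u) (g t) < e / 2" "dist (g t') (g t) < e / 2"
        using u(1) t(3) \<open>\<not> b t \<le> t'\<close>
        by (intro gb[OF t(1)]; simp add: dist_real_def abs_less_iff)+
      with u(2) show False
        using dist_triangle2[of "g u" "g t'" "g t"] by linarith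
    qed
    have "\<exists>q. t < of_rat q \<and> of_rat q < b t" if "t \<in> D e" for t
      using of_rat_dense[OF b[OF that]] by blast
    then obtain q :: "real \<Rightarrow> rat" where q: "\<And>t. t \<in> D e \<Longrightarrow> t < of_rat (q t) \<and> of_rat (q t) < b t"
      by metis
    have "inj_on q (D e)"
    proof (rule linorder_inj_onI)
      fix x y assume "x < y" "x \<in> D e" "y \<in> D e"
      then show "q x \<noteq> q y" using sep[of x y] q[of x] q[of y] by force
    qed auto
    then show ?thesis by (rule countable_image_inj_on[rotated]) simp
  qed
  then have "countable (\<Union>n. D (1 / Suc n))" by simp
  moreover have "{t. a < t \<and> \<not> isCont g t} \<subseteq> (\<Union>n. D (1 / Suc n))"
  proof
    fix t assume "t \<in> {t. a < t \<and> \<not> isCont g t}"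
    then obtain e where e: "e > 0" "\<And>\<delta>. \<delta> > 0 \<Longrightarrow> \<exists>u. dist u t < \<delta> \<and> \<not> dist (g u) (g t) < e" and "a < t"
      by (auto simp: continuous_at_eps_delta)
    obtain n where "1 / Suc n < e" using e(1) nat_approx_posE by blast
    then have "\<exists>u. dist u t < \<delta> \<and> 1 / Suc n \<le> dist (g u) (g t)" if "\<delta> > 0" for \<delta>
      using e(2)[OF that] by force
    then have "t \<in> D (1 / Suc n)"
      unfolding D_def using \<open>a < t\<close> by blast
    then show "t \<in> (\<Union>n. D (1 / Suc n))" by blast
  qed
  ultimately show ?thesis by (rule countable_subset[rotated])
qed

text \<open>\<open>isCont\<close> is two-sided continuity on the whole line. Cadlag paths are
  extensional, hence constantly \<open>undefined\<close> on the negative half-line; the junction 0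
  is conceded as one more exceptional point.\<close>

lemma cadlag_continuous_except_countable:
  assumes "\<eta> \<in> cadlag_paths"
  shows "countable {t. \<not> isCont \<eta> t}"
proof -
  have "isCont \<eta> t" if "t < 0" for t
  proof -
    have "\<forall>\<^sub>F u in nhds t. \<eta> u = undefined"
      using assms eventually_nhds_in_open[of "{..<0}" t] that
      by (auto elim!: eventually_mono simp: cadlag_paths_def extensional_def)
    then show ?thesis by (simp add: isCont_cong)
  qed
  then have "{t. \<not> isCont \<eta> t} \<subseteq> insert 0 {t. 0 < t \<and> \<not> isCont \<eta> t}"
    by (auto simp: not_less) (metis linorder_neqE_linordered_idom)
  moreover have "countable (insert 0 {t. 0 < t \<and> \<not> isCont \<eta> t})"
    using right_continuous_discontinuities_countable[of 0 \<eta>] assms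
    by (auto simp: cadlag_paths_def)
  ultimately show ?thesis by (rule countable_subset)
qed

lemma borel_measurable_cadlag:
  assumes "\<eta> \<in> cadlag_paths"
  shows "\<eta> \<in> borel_measurable borel"
  using cadlag_continuous_except_countable[OF assms]
  by (rule borel_measurable_continuous_countable_exceptions)
     (auto intro: continuous_at_imp_continuous_on)

lemma time_change_zero:
  assumes "\<theta> \<in> time_changes"
  shows "\<theta> 0 = 0"
proof -
  have \<theta>: "strict_mono_on {0..} \<theta>" "\<theta> ` {0..} = {0..}"
    using assms by (auto simp: time_changes_def)
  then obtain w where w: "w \<ge> 0" "\<theta> w = 0" by (metis atLeast_iff imageE order_refl)
  have "\<not> 0 < w"
  proof
    assume "0 < w"
    then have "\<theta> 0 < 0" using strict_mono_onD[OF \<theta>(1), of 0 w] w by simp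
    moreover have "\<theta> 0 \<in> {0..}" using \<theta>(2) by blast
    ultimately show False by simp
  qed
  with w show ?thesis by simp
qed

text \<open>Since the path equals \<open>undefined\<close> to the left of 0, continuity may fail
  there and evaluation at 0 needs its own argument: every time change fixes 0.\<close>

lemma skorokhod_converges_at_zero:
  assumes "skorokhod_converges F \<eta>"
  shows "(\<lambda>n. F n 0) \<longlonglongrightarrow> \<eta> 0"
proof -
  obtain \<theta> where \<theta>: "\<And>n. \<theta> n \<in> time_changes"
    and F: "uniform_limit {0..0} (\<lambda>n t. F n (\<theta> n t)) \<eta> sequentially"
    using assms unfolding skorokhod_converges_def by blast
  show ?thesis
    using tendsto_uniform_limitI[OF F, of 0] by (simp add: time_change_zero \<theta>)
qed

text \<open>Let \<open>w n\<close> be the preimage of \<open>v\<close> under the \<open>n\<close>-th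
  time change. Then \<open>F n v\<close> is close to \<open>\<eta> (w n)\<close> by uniform
  convergence, and \<open>w n\<close> tends to \<open>v\<close>, where \<open>\<eta>\<close> is
  continuous.\<close>

lemma skorokhod_converges_at_continuity_point:
  assumes "skorokhod_converges F \<eta>" "isCont \<eta> v" "0 \<le> v"
  shows "(\<lambda>n. F n v) \<longlonglongrightarrow> \<eta> v"
proof -
  obtain \<theta> where \<theta>: "\<And>n. \<theta> n \<in> time_changes"
    and lim: "uniform_limit {0..} \<theta> (\<lambda>t. t) sequentially"
    and F: "\<And>T. uniform_limit {0..T} (\<lambda>n t. F n (\<theta> n t)) \<eta> sequentially"
    using assms unfolding skorokhod_converges_def by blast
  have "\<exists>w\<ge>0. \<theta> n w = v" for n
  proof -
    have "v \<in> \<theta> n ` {0..}" using \<theta>[of n] assms(3) by (simp add: time_changes_def)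
    then show ?thesis by auto
  qed
  then obtain w where w: "\<And>n. w n \<ge> 0" "\<And>n. \<theta> n (w n) = v" by metis
  have wv: "w \<longlonglongrightarrow> v"
  proof (rule tendstoI)
    fix e :: real assume "e > 0"
    from uniform_limitD[OF lim this] show "\<forall>\<^sub>F n in sequentially. dist (w n) v < e"
      by eventually_elim (metis atLeast_iff dist_commute w)
  qed
  then have \<eta>w: "(\<lambda>n. \<eta> (w n)) \<longlonglongrightarrow> \<eta> v"
    using assms(2) isCont_tendsto_compose by blast
  have "(\<lambda>n. dist (F n v) (\<eta> (w n))) \<longlonglongrightarrow> 0"
  proof (rule tendstoI)
    fix e :: real assume "e > 0"
    \<comment> \<open>The points \<open>w n\<close> may exceed \<open>v\<close>; the horizon
      \<open>v + 1\<close> leaves room for them in the interval of uniform convergence.\<close>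
    have "\<forall>\<^sub>F n in sequentially. w n < v + 1"
      using order_tendstoD(2)[OF wv, of "v + 1"] by simp
    with uniform_limitD[OF F[of "v + 1"] \<open>e > 0\<close>]
    show "\<forall>\<^sub>F n in sequentially. dist (dist (F n v) (\<eta> (w n))) 0 < e"
    proof eventually_elim
      case (elim n)
      then have "dist (F n (\<theta> n (w n))) (\<eta> (w n)) < e" using w(1)[of n] by auto
      then show ?case by (simp add: w)
    qed
  qed
  then have "(\<lambda>n. dist (F n v) (\<eta> (w n)) + dist (\<eta> (w n)) (\<eta> v)) \<longlonglongrightarrow> 0"
    using tendsto_add[OF _ iffD1[OF tendsto_dist_iff \<eta>w]] by force
  then show ?thesis
    unfolding tendsto_dist_iff[of "\<lambda>n. F n v"]
    by (rule tendsto_sandwich[OF _ _ tendsto_const, rotated 2])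
       (auto intro: always_eventually dist_triangle)
qed

section \<open>Integrals of bounded functions over intervals\<close>

lemma set_integrable_bounded_interval:
  fixes h :: "real \<Rightarrow> real"
  assumes [measurable]: "h \<in> borel_measurable borel" and h: "\<And>w. \<bar>h w\<bar> \<le> B"
  shows "set_integrable lborel {a..b} h"
  unfolding set_integrable_def
proof (rule Bochner_Integration.integrable_bound)
  show "integrable lborel (\<lambda>w. indicator {a..b} w *\<^sub>R B)"
    by (simp add: integrable_real_indicator emeasure_lborel_Icc_eq)
  show "AE w in lborel. norm (indicat_real {a..b} w *\<^sub>R h w) \<le> norm (indicat_real {a..b} w *\<^sub>R B)"
    using h by (auto split: split_indicator intro!: order_trans[OF _ abs_ge_self])
qed simp

lemma abs_set_integral_interval_le:
  fixes h :: "real \<Rightarrow> real"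
  assumes [measurable]: "h \<in> borel_measurable borel" and h: "\<And>w. \<bar>h w\<bar> \<le> B" and ab: "a \<le> b"
  shows "\<bar>LINT w:{a..b}|lborel. h w\<bar> \<le> B * (b - a)"
proof -
  have "norm (\<integral>w. indicator {a..b} w *\<^sub>R h w \<partial>lborel) \<le> (\<integral>w. indicator {a..b} w *\<^sub>R B \<partial>lborel)"
    using set_integrable_bounded_interval[OF assms(1) h, of a b] h
    by (intro Bochner_Integration.integral_norm_bound_integral)
       (auto simp: set_integrable_def emeasure_lborel_Icc_eq split: split_indicator)
  also have "\<dots> = B * (b - a)" using ab by simp
  finally show ?thesis by (simp add: set_lebesgue_integral_def)
qed

text \<open>Writing the moving domain as a jointly measurable factor of the integrand turns this
  into measurability of a parameter integral.\<close>

lemma borel_measurable_set_integral_upto: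
  fixes h :: "real \<Rightarrow> real"
  assumes [measurable]: "h \<in> borel_measurable borel"
  shows "(\<lambda>v. LINT w:{0..v}|lborel. h w) \<in> borel_measurable borel"
proof -
  have "(\<lambda>v. \<integral>w. (if 0 \<le> w \<and> w \<le> v then 1 else 0) * h w \<partial>lborel) \<in> borel_measurable borel"
    by (rule lborel.borel_measurable_lebesgue_integral) measurable
  also have "(\<lambda>v. \<integral>w. (if 0 \<le> w \<and> w \<le> v then 1 else 0) * h w \<partial>lborel) = (\<lambda>v. LINT w:{0..v}|lborel. h w)"
    unfolding set_lebesgue_integral_def
    by (intro ext Bochner_Integration.integral_cong) (auto split: split_indicator)
  finally show ?thesis .
qed

text \<open>Lebesgue integrals serve dominated convergence and Fubini, gauge integrals serve the
  fundamental theorem of calculus; this is the bridge between the two.\<close>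

lemma has_integral_set_lborel:
  fixes h :: "real \<Rightarrow> real"
  assumes "set_integrable lborel S h"
  shows "(h has_integral (LINT w:S|lborel. h w)) S"
  using set_borel_integral_eq_integral[OF assms] by (simp add: has_integral_integral)

section \<open>The defect functional and its Skorokhod continuity\<close>

text \<open>The process of the martingale problem: \<open>g\<close> plays the role of the generator
  applied to the test function \<open>f\<close>.\<close>

definition path_defect :: "('a \<Rightarrow> real) \<Rightarrow> ('a \<Rightarrow> real) \<Rightarrow> (real \<Rightarrow> 'a) \<Rightarrow> real \<Rightarrow> real" where
  "path_defect f g \<eta> v = f (\<eta> v) - f (\<eta> 0) - (LINT w:{0..v}|lborel. g (\<eta> w))"

text \<open>Evaluation at a fixed time is not Skorokhod continuous. Integrating over time repairs
  this, because convergence at almost every time is enough; it also allows expectation and time to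
  be exchanged.\<close>

definition total_defect :: "('a \<Rightarrow> real) \<Rightarrow> ('a \<Rightarrow> real) \<Rightarrow> real \<Rightarrow> (real \<Rightarrow> 'a) \<Rightarrow> real" where
  "total_defect f g T \<eta> = (LINT v:{0..T}|lborel. \<bar>path_defect f g \<eta> v\<bar>)"

context
  fixes f g :: "'a::euclidean_space \<Rightarrow> real" and B :: real
  assumes f_cont: "continuous_on UNIV f" and g_cont: "continuous_on UNIV g"
    and f_bound: "\<And>y. \<bar>f y\<bar> \<le> B" and g_bound: "\<And>y. \<bar>g y\<bar> \<le> B"
begin

lemma test_measurable: "f \<in> borel_measurable borel" "g \<in> borel_measurable borel"
  using f_cont g_cont by (auto intro: borel_measurable_continuous_onI)

lemma borel_measurable_path_defect:
  assumes [measurable]: "\<eta> \<in> borel_measurable borel"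
  shows "path_defect f g \<eta> \<in> borel_measurable borel"
proof -
  note test_measurable[measurable]
  have [measurable]: "(\<lambda>v. LINT w:{0..v}|lborel. g (\<eta> w)) \<in> borel_measurable borel"
    by (rule borel_measurable_set_integral_upto) measurable
  show ?thesis unfolding path_defect_def[abs_def] by measurable
qed

lemma abs_path_defect_le:
  assumes [measurable]: "\<eta> \<in> borel_measurable borel" and "0 \<le> v" "v \<le> T"
  shows "\<bar>path_defect f g \<eta> v\<bar> \<le> 2 * B + B * T"
proof -
  note test_measurable[measurable]
  have "\<bar>LINT w:{0..v}|lborel. g (\<eta> w)\<bar> \<le> B * (v - 0)"
    using assms by (intro abs_set_integral_interval_le) (auto simp: g_bound)
  also have "\<dots> \<le> B * T"
    using assms order_trans[OF abs_ge_zero g_bound] by (simp add: mult_left_mono)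
  finally show ?thesis
    using f_bound[of "\<eta> v"] f_bound[of "\<eta> 0"] unfolding path_defect_def by linarith
qed

lemma set_integrable_path_defect:
  assumes [measurable]: "\<eta> \<in> borel_measurable borel"
  shows "set_integrable lborel {0..T} (\<lambda>v. \<bar>path_defect f g \<eta> v\<bar>)"
  unfolding set_integrable_def
proof (rule Bochner_Integration.integrable_bound)
  have [measurable]: "path_defect f g \<eta> \<in> borel_measurable borel"
    by (rule borel_measurable_path_defect) measurable
  show "(\<lambda>v. indicat_real {0..T} v *\<^sub>R \<bar>path_defect f g \<eta> v\<bar>) \<in> borel_measurable lborel"
    by measurable
  show "integrable lborel (\<lambda>w. indicator {0..T} w *\<^sub>R (2 * B + B * T))"
    by (simp add: integrable_real_indicator emeasure_lborel_Icc_eq)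
  show "AE v in lborel. norm (indicat_real {0..T} v *\<^sub>R \<bar>path_defect f g \<eta> v\<bar>)
      \<le> norm (indicat_real {0..T} v *\<^sub>R (2 * B + B * T))"
    using abs_path_defect_le[OF assms]
    by (auto split: split_indicator intro!: order_trans[OF _ abs_ge_self])
qed

lemma total_defect_nonneg: "0 \<le> total_defect f g T \<eta>"
  unfolding total_defect_def set_lebesgue_integral_def by (rule integral_nonneg_AE) simp

lemma total_defect_le:
  assumes [measurable]: "\<eta> \<in> borel_measurable borel" and "0 \<le> T"
  shows "total_defect f g T \<eta> \<le> (2 * B + B * T) * T"
proof -
  have "total_defect f g T \<eta> \<le> (\<integral>v. indicator {0..T} v *\<^sub>R (2 * B + B * T) \<partial>lborel)"
    unfolding total_defect_def set_lebesgue_integral_def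
    using set_integrable_path_defect[OF assms(1)] abs_path_defect_le[OF assms(1)]
    by (intro integral_mono) (auto simp: set_integrable_def emeasure_lborel_Icc_eq split: split_indicator)
  then show ?thesis using assms(2) by (simp add: ac_simps)
qed

text \<open>The paths converge at all but countably many times, so dominated convergence treats the
  integral; the other two terms are evaluations at a continuity point and at 0.\<close>

lemma path_defect_tendsto:
  assumes F: "\<And>n. F n \<in> cadlag_paths" and \<eta>: "\<eta> \<in> cadlag_paths"
    and conv: "skorokhod_converges F \<eta>" and v: "isCont \<eta> v" "0 \<le> v"
  shows "(\<lambda>n. path_defect f g (F n) v) \<longlonglongrightarrow> path_defect f g \<eta> v"
proof -
  note [measurable] = test_measurable borel_measurable_cadlag[OF F] borel_measurable_cadlag[OF \<eta>]
  have fc: "(\<lambda>n. f (X n)) \<longlonglongrightarrow> f y" and gc: "(\<lambda>n. g (X n)) \<longlonglongrightarrow> g y" if "X \<longlonglongrightarrow> y" for X y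
    using that f_cont g_cont by (auto intro: continuous_on_tendsto_compose[where s = UNIV])
  have "(\<lambda>n. \<integral>w. indicator {0..v} w *\<^sub>R g (F n w) \<partial>lborel) \<longlonglongrightarrow> (\<integral>w. indicator {0..v} w *\<^sub>R g (\<eta> w) \<partial>lborel)"
  proof (rule integral_dominated_convergence)
    show "integrable lborel (\<lambda>w. indicator {0..v} w *\<^sub>R B)"
      by (simp add: integrable_real_indicator emeasure_lborel_Icc_eq)
    have "AE w in lborel. w \<notin> {t. \<not> isCont \<eta> t}"
      by (intro AE_not_in countable_imp_null_set_lborel cadlag_continuous_except_countable \<eta>)
    then show "AE w in lborel. (\<lambda>n. indicator {0..v} w *\<^sub>R g (F n w)) \<longlonglongrightarrow> indicator {0..v} w *\<^sub>R g (\<eta> w)"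
    proof eventually_elim
      case (elim w)
      then show ?case
        using skorokhod_converges_at_continuity_point[OF conv, of w]
        by (cases "w \<in> {0..v}") (auto intro: gc)
    qed
    show "AE w in lborel. norm (indicat_real {0..v} w *\<^sub>R g (F n w)) \<le> indicat_real {0..v} w *\<^sub>R B" for n
      using g_bound by (auto split: split_indicator)
  qed measurable
  then show ?thesis
    unfolding path_defect_def set_lebesgue_integral_def
    by (intro tendsto_diff fc skorokhod_converges_at_continuity_point[OF conv v]
        skorokhod_converges_at_zero[OF conv])
qed

lemma total_defect_tendsto:
  assumes F: "\<And>n. F n \<in> cadlag_paths" and \<eta>: "\<eta> \<in> cadlag_paths"
    and conv: "skorokhod_converges F \<eta>"
  shows "(\<lambda>n. total_defect f g T (F n)) \<longlonglongrightarrow> total_defect f g T \<eta>"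
  unfolding total_defect_def set_lebesgue_integral_def
proof (rule integral_dominated_convergence)
  have [measurable]: "path_defect f g (F n) \<in> borel_measurable borel" for n
    by (intro borel_measurable_path_defect borel_measurable_cadlag F)
  have [measurable]: "path_defect f g \<eta> \<in> borel_measurable borel"
    by (intro borel_measurable_path_defect borel_measurable_cadlag \<eta>)
  show "(\<lambda>v. indicat_real {0..T} v *\<^sub>R \<bar>path_defect f g (F n) v\<bar>) \<in> borel_measurable lborel" for n
    by measurable
  show "(\<lambda>v. indicat_real {0..T} v *\<^sub>R \<bar>path_defect f g \<eta> v\<bar>) \<in> borel_measurable lborel"
    by measurable
  show "integrable lborel (\<lambda>w. indicator {0..T} w *\<^sub>R (2 * B + B * T))"
    by (simp add: integrable_real_indicator emeasure_lborel_Icc_eq)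
  have "AE w in lborel. w \<notin> {t. \<not> isCont \<eta> t}"
    by (intro AE_not_in countable_imp_null_set_lborel cadlag_continuous_except_countable \<eta>)
  then show "AE v in lborel. (\<lambda>n. indicator {0..T} v *\<^sub>R \<bar>path_defect f g (F n) v\<bar>)
      \<longlonglongrightarrow> indicator {0..T} v *\<^sub>R \<bar>path_defect f g \<eta> v\<bar>"
  proof eventually_elim
    case (elim v)
    then show ?case
      using path_defect_tendsto[OF F \<eta> conv, of v]
      by (cases "v \<in> {0..T}") (auto intro: tendsto_rabs)
  qed
  show "AE v in lborel. norm (indicat_real {0..T} v *\<^sub>R \<bar>path_defect f g (F n) v\<bar>)
      \<le> indicat_real {0..T} v *\<^sub>R (2 * B + B * T)" for n
    using abs_path_defect_le[OF borel_measurable_cadlag[OF F]] by (auto split: split_indicator)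
qed

text \<open>Open sets of this topology are the sequentially open ones, so sequential continuity
  already gives open preimages.\<close>

lemma continuous_map_total_defect:
  "continuous_map skorokhod_topology euclideanreal (total_defect f g T)"
  unfolding continuous_map_def topspace_skorokhod_topology openin_skorokhod_topology
proof (intro conjI allI impI)
  fix U :: "real set" assume "openin euclidean U"
  then have U: "open U" by simp
  show "skorokhod_open {\<eta> \<in> cadlag_paths. total_defect f g T \<eta> \<in> U}"
    unfolding skorokhod_open_def
  proof (intro conjI ballI allI impI)
    fix \<eta> :: "real \<Rightarrow> 'a" and F :: "nat \<Rightarrow> real \<Rightarrow> 'a"
    assume \<eta>: "\<eta> \<in> {\<eta> \<in> cadlag_paths. total_defect f g T \<eta> \<in> U}"
      and F: "\<forall>n. F n \<in> cadlag_paths" "skorokhod_converges F \<eta>"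
    then have "\<forall>\<^sub>F n in sequentially. total_defect f g T (F n) \<in> U"
      using topological_tendstoD[OF total_defect_tendsto U] by blast
    then show "\<forall>\<^sub>F n in sequentially. F n \<in> {\<eta> \<in> cadlag_paths. total_defect f g T \<eta> \<in> U}"
      using F by (auto elim: eventually_mono)
  qed auto
qed auto

text \<open>Along a continuous path the defect is continuous in time, so a vanishing time integral
  of its absolute value makes it vanish at every time. The horizons are natural numbers so that
  countably many almost sure statements provide the hypothesis.\<close>

lemma total_defect_zeroD:
  assumes zero: "\<And>n::nat. total_defect f g n \<eta> = 0" and \<eta>: "\<eta> \<in> continuous_paths" and v: "0 \<le> v"
  shows "((\<lambda>w. g (\<eta> w)) has_integral (f (\<eta> v) - f (\<eta> 0))) {0..v}"
proof -
  have cont: "continuous_on {0..} \<eta>" using \<eta> by (simp add: continuous_paths_def)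
  then have \<eta>_cadlag: "\<eta> \<in> cadlag_paths"
  proof -
    have "(\<eta> \<longlongrightarrow> \<eta> t) (at_right t)" if "0 \<le> t" for t
      using cont that unfolding continuous_on_def
      by (auto intro: tendsto_within_subset[of \<eta> _ t "{0..}"])
    moreover have "(\<eta> \<longlongrightarrow> \<eta> t) (at_left t)" if "0 < t" for t
    proof -
      have "at t within {0..} = at t"
        using that at_within_interior[of t "{0..}"] by simp
      then show ?thesis
        using cont that unfolding continuous_on_def
        by (metis atLeast_iff filterlim_at_split less_imp_le)
    qed
    ultimately show ?thesis
      using \<eta> by (auto simp: cadlag_paths_def continuous_paths_def)
  qed
  note [measurable] = test_measurable borel_measurable_cadlag[OF \<eta>_cadlag]
  have g_cont': "continuous_on {0..v} (\<lambda>w. g (\<eta> w))" for v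
    using continuous_on_compose2[OF g_cont continuous_on_subset[OF cont, of "{0..v}"]] by auto
  have HK: "((\<lambda>w. g (\<eta> w)) has_integral (LINT w:{0..v}|lborel. g (\<eta> w))) {0..v}" for v
    using g_bound by (intro has_integral_set_lborel set_integrable_bounded_interval) auto
  obtain n :: nat where n: "v < n" using reals_Archimedean2 by blast
  let ?d = "path_defect f g \<eta>"
  have d_cont: "continuous_on {0..real n} (\<lambda>w. \<bar>?d w\<bar>)"
  proof -
    have "continuous_on {0..real n} (\<lambda>w. f (\<eta> w))"
      using continuous_on_compose2[OF f_cont continuous_on_subset[OF cont, of "{0..real n}"]] by auto
    moreover have "continuous_on {0..real n} (\<lambda>w. integral {0..w} (\<lambda>w. g (\<eta> w)))"
      using g_cont' by (intro indefinite_integral_continuous_1 integrable_continuous_real)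
    ultimately show ?thesis
      unfolding path_defect_def using integral_unique[OF HK] by (auto intro!: continuous_intros)
  qed
  have "((\<lambda>w. \<bar>?d w\<bar>) has_integral total_defect f g n \<eta>) {0..real n}"
    unfolding total_defect_def
    by (intro has_integral_set_lborel set_integrable_path_defect) simp
  \<comment> \<open>The strict inequality \<open>v < n\<close> makes the interval nondegenerate,
    without which a zero integral would say nothing about the value at \<open>v\<close>.\<close>
  then have "\<bar>?d v\<bar> = 0"
    using zero[of n] n v d_cont
    by (intro has_integral_0_cbox_imp_0[of 0 "real n" "\<lambda>w. \<bar>?d w\<bar>" v]) auto
  then have "(LINT w:{0..v}|lborel. g (\<eta> w)) = f (\<eta> v) - f (\<eta> 0)"
    by (simp add: path_defect_def)
  with HK[of v] show ?thesis by simp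
qed

end

section \<open>Borel sets of an abstract topology\<close>

lemma sets_borel_of_topology: "sets (borel_of_topology X) = sigma_sets (topspace X) {U. openin X U}"
  unfolding borel_of_topology_def by (rule sets_measure_of) (auto dest: openin_subset)

lemma space_borel_of_topology: "space (borel_of_topology X) = topspace X"
  unfolding borel_of_topology_def by (rule space_measure_of) (auto dest: openin_subset)

lemma continuous_map_borel_measurable:
  assumes "continuous_map X euclidean h"
  shows "h \<in> borel_measurable (borel_of_topology X)"
proof (rule borel_measurableI)
  fix U :: "'b set" assume "open U"
  then have "openin X {x \<in> topspace X. h x \<in> U}"
    using assms openin_continuous_map_preimage by fastforce
  moreover have "h -` U \<inter> space (borel_of_topology X) = {x \<in> topspace X. h x \<in> U}"
    by (auto simp: space_borel_of_topology)
  ultimately show "h -` U \<inter> space (borel_of_topology X) \<in> sets (borel_of_topology X)"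
    by (auto simp: sets_borel_of_topology)
qed

section \<open>Step paths\<close>

lemma nat_floor_mult_eq_iff:
  fixes c t :: real
  assumes "0 < c" "0 \<le> t"
  shows "nat \<lfloor>t * c\<rfloor> = n \<longleftrightarrow> n / c \<le> t \<and> t < Suc n / c"
proof -
  have "0 \<le> t * c" using assms by simp
  then have "nat \<lfloor>t * c\<rfloor> = n \<longleftrightarrow> \<lfloor>t * c\<rfloor> = int n" by linarith
  also have "\<dots> \<longleftrightarrow> n \<le> t * c \<and> t * c < Suc n" by (simp add: floor_eq_iff add.commute)
  finally show ?thesis using assms by (simp add: divide_le_eq less_divide_eq del: of_nat_Suc)
qed

lemma has_integral_step_function:
  fixes G :: "nat \<Rightarrow> real"
  assumes c: "0 < c"
  shows "((\<lambda>w. G (nat \<lfloor>w * c\<rfloor>)) has_integral (\<Sum>k<n. G k) / c) {0..n / c}"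
proof (induction n)
  case (Suc n)
  have "((\<lambda>w. G n) has_integral G n / c) {n / c..Suc n / c}"
    using has_integral_const_real[of "G n" "n / c" "Suc n / c"] c by (simp add: field_simps)
  then have "((\<lambda>w. G (nat \<lfloor>w * c\<rfloor>)) has_integral G n / c) {n / c..Suc n / c}"
  \<comment> \<open>The right endpoint already belongs to the next step; being a single point, it
    does not affect the integral.\<close>
  proof (rule has_integral_spike_finite[rotated 2])
    fix w assume w: "w \<in> {n / c..Suc n / c} - {Suc n / c}"
    moreover from this have "0 \<le> w" using c by (auto intro: order_trans[rotated])
    ultimately have "nat \<lfloor>w * c\<rfloor> = n"
      using c by (subst nat_floor_mult_eq_iff) (auto simp: add.commute)
    then show "G (nat \<lfloor>w * c\<rfloor>) = G n" by simp
  qed simp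
  from has_integral_combine[OF _ _ Suc.IH this] c show ?case
    by (simp add: add_divide_distrib divide_right_mono)
qed (use has_integral_refl(2) in force)

text \<open>The complete steps contribute exactly the sum; the error is the last, incomplete step,
  of length at most \<open>1 / c\<close>.\<close>

lemma step_function_integral_error:
  fixes G :: "nat \<Rightarrow> real"
  assumes c: "0 < c" and G: "\<And>k. \<bar>G k\<bar> \<le> B" and v: "0 \<le> v"
  shows "\<bar>(LINT w:{0..v}|lborel. G (nat \<lfloor>w * c\<rfloor>)) - (\<Sum>k<nat \<lfloor>v * c\<rfloor>. G k) / c\<bar> \<le> B / c"
proof -
  define n where "n = nat \<lfloor>v * c\<rfloor>"
  then have n: "n / c \<le> v" "v < Suc n / c" using iffD1[OF nat_floor_mult_eq_iff[OF c v] n_def[symmetric]] by blast+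
  let ?h = "\<lambda>w. G (nat \<lfloor>w * c\<rfloor>)"
  have h: "?h \<in> borel_measurable borel" by measurable
  have HK: "(?h has_integral (LINT w:{a..b}|lborel. ?h w)) {a..b}" for a b
    by (rule has_integral_set_lborel, rule set_integrable_bounded_interval[OF h]) (rule G)
  have "(LINT w:{0..v}|lborel. ?h w) = (LINT w:{0..n/c}|lborel. ?h w) + (LINT w:{n/c..v}|lborel. ?h w)"
  proof (rule has_integral_unique[OF HK])
    show "(?h has_integral ((LINT w:{0..n/c}|lborel. ?h w) + (LINT w:{n/c..v}|lborel. ?h w))) {0..v}"
      using c n(1) by (intro has_integral_combine[where c = "n / c"] HK) auto
  qed
  moreover have "(LINT w:{0..n/c}|lborel. ?h w) = (\<Sum>k<n. G k) / c"
    by (rule has_integral_unique[OF HK has_integral_step_function[OF c]])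
  moreover have "\<bar>LINT w:{n/c..v}|lborel. ?h w\<bar> \<le> B * (v - n / c)"
    by (rule abs_set_integral_interval_le[OF h G n(1)])
  moreover have "B * (v - n / c) \<le> B * (1 / c)"
    using n(2) order_trans[OF abs_ge_zero G] by (intro mult_left_mono) (auto simp: add_divide_distrib)
  ultimately show ?thesis by (simp add: n_def)
qed

text \<open>For \<open>c = r powr (1 + \<beta>)\<close> this is the rescaled path. As a map of the
  whole sequence \<open>X\<close> it is continuous, which yields measurability of the rescaled chain
  as a random path.\<close>

definition step_path :: "real \<Rightarrow> real \<Rightarrow> (nat \<Rightarrow> 'a::real_normed_vector) \<Rightarrow> real \<Rightarrow> 'a" where
  "step_path r c X = (\<lambda>t\<in>{0..}. (1 / r) *\<^sub>R X (nat \<lfloor>t * c\<rfloor>))"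

lemma step_path_cadlag:
  assumes c: "0 < c"
  shows "step_path r c X \<in> cadlag_paths"
proof -
  have eq: "step_path r c X w = (1 / r) *\<^sub>R X n" if "0 \<le> w" "n / c \<le> w" "w < Suc n / c" for w n
    using that nat_floor_mult_eq_iff[OF c, of w n] by (simp add: step_path_def)
  have right: "(step_path r c X \<longlongrightarrow> step_path r c X t) (at_right t)" if t: "0 \<le> t" for t
  proof -
    define n where "n = nat \<lfloor>t * c\<rfloor>"
    then have n: "n / c \<le> t" "t < Suc n / c" using iffD1[OF nat_floor_mult_eq_iff[OF c t] n_def[symmetric]] by blast+
    have "\<forall>\<^sub>F w in at_right t. w \<in> {t<..<Suc n / c}"
      using n(2) by (rule eventually_at_right_real)
    then have "\<forall>\<^sub>F w in at_right t. step_path r c X t = step_path r c X w"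
      by eventually_elim (use eq[of _ n] t n in auto)
    then show ?thesis by (rule tendsto_cong[THEN iffD1]) simp
  qed
  have left: "\<exists>l. (step_path r c X \<longlongrightarrow> l) (at_left t)" if t: "0 < t" for t
  proof -
    \<comment> \<open>The left limit is the value of the step just before \<open>t\<close>. At grid
      times this is not the step containing \<open>t\<close>, so the index is a ceiling minus one
      and not a floor.\<close>
    define m where "m = nat \<lceil>t * c\<rceil> - 1"
    have "0 < t * c" using t c by simp
    then have "real m < t * c" "t * c \<le> real m + 1" unfolding m_def by linarith+
    then have m: "m / c < t" "t \<le> Suc m / c" using c by (auto simp: field_simps)
    have "\<forall>\<^sub>F w in at_left t. w \<in> {m / c<..<t}"
      using m(1) by (rule eventually_at_left_real)
    then have "\<forall>\<^sub>F w in at_left t. (1 / r) *\<^sub>R X m = step_path r c X w"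
    proof eventually_elim
      case (elim w)
      moreover have "0 \<le> real m / c" using c by simp
      ultimately show ?case using eq[of w m] m by auto
    qed
    then have "(step_path r c X \<longlongrightarrow> (1 / r) *\<^sub>R X m) (at_left t)"
      by (rule tendsto_cong[THEN iffD1]) simp
    then show ?thesis by blast
  qed
  show ?thesis using left right by (auto simp: cadlag_paths_def step_path_def)
qed

lemma skorokhod_converges_uniform:
  assumes "\<And>T. uniform_limit {0..T} F \<eta> sequentially"
  shows "skorokhod_converges F \<eta>"
  unfolding skorokhod_converges_def
proof (intro exI conjI allI)
  show "(\<lambda>t. t) \<in> time_changes" by (auto simp: time_changes_def strict_mono_on_def)
qed (use assms in \<open>auto intro: uniform_limit_const\<close>)

text \<open>Only finitely many indices occur up to a given time, so coordinatewise convergence of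
  the sequences is uniform there, and the identity serves as time change.\<close>

lemma step_path_continuous:
  assumes c: "0 < c" and X: "X \<longlonglongrightarrow> Y"
  shows "skorokhod_converges (\<lambda>n. step_path r c (X n)) (step_path r c Y)"
proof (rule skorokhod_converges_uniform, rule uniform_limitI)
  fix T e :: real assume e: "0 < e"
  have "(\<lambda>n. (1 / r) *\<^sub>R X n k) \<longlonglongrightarrow> (1 / r) *\<^sub>R Y k" for k
    by (intro tendsto_intros continuous_on_tendsto_compose[OF continuous_on_product_coordinates X]) auto
  from tendstoD[OF this e]
  have "\<forall>\<^sub>F n in sequentially. \<forall>k\<in>{..nat \<lfloor>T * c\<rfloor>}. dist ((1 / r) *\<^sub>R X n k) ((1 / r) *\<^sub>R Y k) < e"
    by (intro eventually_ball_finite) auto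
  then show "\<forall>\<^sub>F n in sequentially. \<forall>t\<in>{0..T}. dist (step_path r c (X n) t) (step_path r c Y t) < e"
  proof eventually_elim
    case (elim n)
    show ?case
    proof
      fix t assume t: "t \<in> {0..T}"
      then have "nat \<lfloor>t * c\<rfloor> \<le> nat \<lfloor>T * c\<rfloor>"
        using c by (intro nat_mono floor_mono mult_right_mono) auto
      with elim t show "dist (step_path r c (X n) t) (step_path r c Y t) < e"
        by (simp add: step_path_def)
    qed
  qed
qed

text \<open>The map from sequences to paths is continuous from the product topology to the Skorokhod
  topology, and the chain as a random sequence is Borel measurable for the product topology.\<close>

lemma measurable_step_path:
  fixes X :: "nat \<Rightarrow> 'w \<Rightarrow> 'a::euclidean_space"
  assumes c: "0 < c" and X: "\<And>k. X k \<in> borel_measurable M"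
  shows "(\<lambda>\<omega>. step_path r c (\<lambda>k. X k \<omega>)) \<in> M \<rightarrow>\<^sub>M borel_of_topology skorokhod_topology"
  unfolding borel_of_topology_def
proof (rule measurable_measure_of)
  show "{U. openin skorokhod_topology U} \<subseteq> Pow (topspace skorokhod_topology)"
    using openin_subset by blast
  show "(\<lambda>\<omega>. step_path r c (\<lambda>k. X k \<omega>)) \<in> space M \<rightarrow> topspace skorokhod_topology"
    by (simp add: topspace_skorokhod_topology step_path_cadlag c)
  fix U :: "(real \<Rightarrow> 'a) set" assume "U \<in> {U. openin skorokhod_topology U}"
  then have U: "skorokhod_open U" by (simp add: openin_skorokhod_topology)
  then have U_seq: "\<forall>\<^sub>F n in sequentially. F n \<in> U"
    if "\<eta> \<in> U" "\<And>n. F n \<in> cadlag_paths" "skorokhod_converges F \<eta>" for F \<eta>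
    using that unfolding skorokhod_open_def by simp
  have "open {x. step_path r c x \<in> U}"
  proof (rule open_subopen[THEN iffD2], rule ballI)
    fix x assume x: "x \<in> {x. step_path r c x \<in> U}"
    \<comment> \<open>The space of sequences is first countable, so neighbourhoods can be tested by
      convergent sequences, the only tests that Skorokhod openness provides.\<close>
    have "\<forall>\<^sub>F x in nhds x. step_path r c x \<in> U"
      unfolding eventually_nhds_iff_sequentially
    proof (intro allI impI)
      fix X :: "nat \<Rightarrow> nat \<Rightarrow> 'a" assume "X \<longlonglongrightarrow> x"
      from step_path_continuous[OF c this, of r]
      show "\<forall>\<^sub>F n in sequentially. step_path r c (X n) \<in> U"
        using x by (intro U_seq) (auto intro: step_path_cadlag c)
    qed
    then show "\<exists>T. open T \<and> x \<in> T \<and> T \<subseteq> {x. step_path r c x \<in> U}"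
      unfolding eventually_nhds by auto
  qed
  moreover have "(\<lambda>\<omega> k. X k \<omega>) \<in> borel_measurable M"
    by (rule measurable_coordinatewise_then_product) (rule X)
  ultimately have "(\<lambda>\<omega> k. X k \<omega>) -` {x. step_path r c x \<in> U} \<inter> space M \<in> sets M"
    by (intro measurable_sets[of _ M borel]) auto
  then show "(\<lambda>\<omega>. step_path r c (\<lambda>k. X k \<omega>)) -` U \<inter> space M \<in> sets M"
    by (simp add: vimage_def)
qed

section \<open>Test functions\<close>

text \<open>Truncation confines the support to the ball, the outer square makes the gradient
  continuous across the sphere, and inside the ball a square root recovers the squared distance to
  \<open>c\<close>.\<close>

definition bump :: "'a::euclidean_space \<Rightarrow> real \<Rightarrow> 'a \<Rightarrow> real" where
  "bump c \<rho> y = (max 0 (\<rho>\<^sup>2 - (norm (y - c))\<^sup>2))\<^sup>2"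

text \<open>That this is the gradient of \<open>bump\<close> enters only through the remainder
  estimate \<open>bump_second_order\<close>.\<close>

definition bump_grad :: "'a::euclidean_space \<Rightarrow> real \<Rightarrow> 'a \<Rightarrow> 'a" where
  "bump_grad c \<rho> y = (- 4 * max 0 (\<rho>\<^sup>2 - (norm (y - c))\<^sup>2)) *\<^sub>R (y - c)"

lemma continuous_on_bump: "continuous_on S (bump c \<rho>)"
  unfolding bump_def by (intro continuous_intros)

lemma continuous_on_bump_grad: "continuous_on S (bump_grad c \<rho>)"
  unfolding bump_grad_def by (intro continuous_intros)

lemma bump_outside:
  assumes "0 < \<rho>" "\<rho> \<le> norm (y - c)"
  shows "bump c \<rho> y = 0" "bump_grad c \<rho> y = 0"
  using power_mono[of \<rho> "norm (y - c)" 2] assms by (simp_all add: bump_def bump_grad_def)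

lemma abs_bump_le:
  assumes "0 < \<rho>"
  shows "\<bar>bump c \<rho> y\<bar> \<le> \<rho> ^ 4"
proof -
  have "(max 0 (\<rho>\<^sup>2 - (norm (y - c))\<^sup>2))\<^sup>2 \<le> (\<rho>\<^sup>2)\<^sup>2" by (intro power_mono) auto
  then show ?thesis by (simp add: bump_def)
qed

lemma norm_bump_grad_le:
  assumes "0 < \<rho>"
  shows "norm (bump_grad c \<rho> y) \<le> 4 * \<rho> ^ 3"
proof (cases "norm (y - c) \<le> \<rho>")
  case True
  then have "max 0 (\<rho>\<^sup>2 - (norm (y - c))\<^sup>2) * norm (y - c) \<le> \<rho>\<^sup>2 * \<rho>"
    by (intro mult_mono) auto
  then show ?thesis
    by (simp add: bump_grad_def abs_mult power2_eq_square power3_eq_cube)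
next
  case False
  with assms show ?thesis by (simp add: bump_outside)
qed

text \<open>\<open>bump\<close> is \<open>(max 0 s)\<^sup>2\<close> for a quadratic polynomial
  \<open>s\<close>. The outer function has first-order remainder at most the square of the increment
  of \<open>s\<close>, and for steps of length at most 1 that increment is at most
  \<open>2 * \<rho> + 3\<close> times the step, unless both ends lie outside the ball.\<close>

lemma bump_second_order:
  assumes \<rho>: "0 < \<rho>" and w: "norm (b - a) \<le> 1"
  shows "\<bar>bump c \<rho> b - bump c \<rho> a - bump_grad c \<rho> a \<bullet> (b - a)\<bar>
           \<le> ((2 * \<rho> + 3)\<^sup>2 + 2 * \<rho>\<^sup>2) * (norm (b - a))\<^sup>2"
proof (cases "norm (a - c) \<le> \<rho> + 1")
  case True
  define w' where "w' = norm (b - a)"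
  define s where "s = \<rho>\<^sup>2 - (norm (a - c))\<^sup>2"
  define s' where "s' = \<rho>\<^sup>2 - (norm (b - c))\<^sup>2"
  define P where "P = max 0 s"
  have P: "0 \<le> P" "P \<le> \<rho>\<^sup>2" by (auto simp: P_def s_def)
  have diff: "s' - s = - 2 * ((a - c) \<bullet> (b - a)) - w'\<^sup>2"
    unfolding s_def s'_def w'_def power2_norm_eq_inner
    by (simp add: inner_diff_left inner_diff_right inner_commute algebra_simps)
  \<comment> \<open>The gradient term is the linear term of the outer square up to the quadratic
    part of \<open>s\<close>, which accounts for the summand \<open>2 * \<rho>\<^sup>2\<close> of
    the constant.\<close>
  have grad: "bump_grad c \<rho> a \<bullet> (b - a) = 2 * P * (s' - s + w'\<^sup>2)"
    unfolding diff bump_grad_def by (simp add: P_def s_def)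
  have w1: "w'\<^sup>2 \<le> w' * 1"
    using w by (simp add: w'_def power2_eq_square mult_left_le)
  have "\<bar>s' - s\<bar> \<le> 2 * \<bar>(a - c) \<bullet> (b - a)\<bar> + w'\<^sup>2"
    unfolding diff using zero_le_power2[of w'] by linarith
  also have "\<dots> \<le> 2 * (norm (a - c) * w') + w' * 1"
    using Cauchy_Schwarz_ineq2[of "a - c" "b - a"] w1 unfolding w'_def by linarith
  also have "\<dots> \<le> 2 * ((\<rho> + 1) * w') + w' * 1"
    using True by (intro add_mono mult_left_mono mult_right_mono) (auto simp: w'_def)
  finally have "\<bar>s' - s\<bar> \<le> (2 * \<rho> + 3) * w'" by (simp add: algebra_simps)
  then have "\<bar>s' - s\<bar>\<^sup>2 \<le> ((2 * \<rho> + 3) * w')\<^sup>2" by (rule power_mono) simp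
  then have sq: "(s' - s)\<^sup>2 \<le> (2 * \<rho> + 3)\<^sup>2 * w'\<^sup>2" by (simp add: power_mult_distrib)
  have "\<bar>(max 0 s')\<^sup>2 - P\<^sup>2 - 2 * P * (s' - s)\<bar> \<le> (s' - s)\<^sup>2"
  proof (cases "0 \<le> s")
    case s: True
    then show ?thesis
    proof (cases "0 \<le> s'")
      case True
      have "s'\<^sup>2 - s\<^sup>2 - 2 * s * (s' - s) = (s' - s)\<^sup>2" by (simp add: power2_eq_square algebra_simps)
      with s True show ?thesis by (simp add: P_def)
    next
      case False
      then have "s' * s \<le> 0" using s by (simp add: mult_nonpos_nonneg)
      then have "0 \<le> s\<^sup>2 - 2 * s * s'" "s\<^sup>2 - 2 * s * s' \<le> (s' - s)\<^sup>2"
        using zero_le_power2[of s] zero_le_power2[of s'] power2_diff[of s' s]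
          mult.assoc[of 2 s s'] mult.assoc[of 2 s' s] mult.commute[of s s'] by linarith+
      moreover have "(max 0 s')\<^sup>2 - P\<^sup>2 - 2 * P * (s' - s) = s\<^sup>2 - 2 * s * s'"
        using False s by (simp add: P_def power2_eq_square algebra_simps)
      ultimately show ?thesis by simp
    qed
  next
    case s: False
    then have "max 0 s' \<le> \<bar>s' - s\<bar>" by auto
    then have "(max 0 s')\<^sup>2 \<le> \<bar>s' - s\<bar>\<^sup>2" by (rule power_mono) simp
    with s show ?thesis by (simp add: P_def)
  qed
  moreover have "bump c \<rho> b - bump c \<rho> a - bump_grad c \<rho> a \<bullet> (b - a)
      = ((max 0 s')\<^sup>2 - P\<^sup>2 - 2 * P * (s' - s)) - 2 * P * w'\<^sup>2"
    unfolding grad by (simp add: bump_def s_def s'_def P_def algebra_simps)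
  moreover have "0 \<le> 2 * P * w'\<^sup>2" "2 * P * w'\<^sup>2 \<le> 2 * \<rho>\<^sup>2 * w'\<^sup>2"
    using P by (auto intro: mult_right_mono)
  ultimately have "\<bar>bump c \<rho> b - bump c \<rho> a - bump_grad c \<rho> a \<bullet> (b - a)\<bar>
      \<le> (2 * \<rho> + 3)\<^sup>2 * w'\<^sup>2 + 2 * \<rho>\<^sup>2 * w'\<^sup>2"
    using sq by linarith
  then show ?thesis by (simp add: w'_def distrib_right)
next
  case False
  \<comment> \<open>From beyond distance \<open>\<rho> + 1\<close> a step of length at most 1 cannot
    enter the ball, so every term is zero.\<close>
  then have "\<rho> \<le> norm (a - c)" "\<rho> \<le> norm (b - c)"
    using w norm_triangle_ineq2[of "a - c" "a - b"] by (auto simp: norm_minus_commute)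
  with \<rho> show ?thesis by (simp add: bump_outside)
qed

text \<open>Only moments of order \<open>q\<close> between 1 and 2 are at hand. Short steps use the
  second-order bound and \<open>w\<^sup>2 \<le> w powr q\<close>; steps longer than 1 use
  boundedness of the function and its gradient together with
  \<open>w \<le> w powr q\<close>.\<close>

lemma bump_estimates:
  assumes \<rho>: "0 < \<rho>" and q: "1 \<le> q" "q \<le> 2"
  obtains M where "0 < M" "\<And>y. \<bar>bump c \<rho> y\<bar> \<le> M"
    "\<And>a b. \<bar>bump c \<rho> b - bump c \<rho> a - bump_grad c \<rho> a \<bullet> (b - a)\<bar> \<le> M * norm (b - a) powr q"
    "\<And>a b. (bump c \<rho> b - bump c \<rho> a)\<^sup>2 \<le> M * norm (b - a) powr q"
proof
  define A where "A = \<rho> ^ 4"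
  define G where "G = 4 * \<rho> ^ 3"
  define C where "C = (2 * \<rho> + 3)\<^sup>2 + 2 * \<rho>\<^sup>2"
  \<comment> \<open>One constant for all cases: \<open>2 * A + G\<close> for the remainder on long
    steps, \<open>C\<close> on short ones; \<open>4 * A\<^sup>2\<close> for the squared increment on
    long steps, \<open>(G + C)\<^sup>2\<close> on short ones.\<close>
  define M where "M = 2 * A + G + C + 4 * A\<^sup>2 + (G + C)\<^sup>2"
  have pos: "0 < A" "0 < G" "0 < C" using \<rho> by (auto simp: A_def G_def C_def intro: add_nonneg_pos)
  have sq: "0 \<le> A\<^sup>2" "0 \<le> (G + C)\<^sup>2" by auto
  show "0 < M" using pos sq unfolding M_def by linarith
  have A: "\<bar>bump c \<rho> y\<bar> \<le> A" and G: "norm (bump_grad c \<rho> y) \<le> G" for y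
    using abs_bump_le[OF \<rho>] norm_bump_grad_le[OF \<rho>] by (auto simp: A_def G_def)
  show "\<bar>bump c \<rho> y\<bar> \<le> M" for y
    using A[of y] pos sq unfolding M_def by linarith
  fix a b :: 'a
  define w where "w = norm (b - a)"
  have inner: "\<bar>bump_grad c \<rho> a \<bullet> (b - a)\<bar> \<le> G * w"
    unfolding w_def
    by (rule order_trans[OF Cauchy_Schwarz_ineq2 mult_right_mono[OF G]]) simp
  have AA: "\<bar>bump c \<rho> b - bump c \<rho> a\<bar> \<le> 2 * A" using A[of a] A[of b] by linarith
  have "\<bar>bump c \<rho> b - bump c \<rho> a - bump_grad c \<rho> a \<bullet> (b - a)\<bar> \<le> M * w powr q
      \<and> (bump c \<rho> b - bump c \<rho> a)\<^sup>2 \<le> M * w powr q"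
  proof (cases "w \<le> 1")
    case True
    then have wq: "w\<^sup>2 \<le> w powr q"
      using powr_mono'[of q 2 w] q by (cases "w = 0") (auto simp: w_def)
    have 1: "\<bar>bump c \<rho> b - bump c \<rho> a - bump_grad c \<rho> a \<bullet> (b - a)\<bar> \<le> C * w\<^sup>2"
      using bump_second_order[OF \<rho>, of b a c] True by (simp add: w_def C_def)
    moreover have "C * w\<^sup>2 \<le> C * w"
      using True pos by (intro mult_left_mono) (auto simp: w_def power2_eq_square intro: mult_left_le)
    ultimately have "\<bar>bump c \<rho> b - bump c \<rho> a\<bar> \<le> (G + C) * w"
      using inner by (auto simp: distrib_right)
    then have "\<bar>bump c \<rho> b - bump c \<rho> a\<bar>\<^sup>2 \<le> ((G + C) * w)\<^sup>2" by (rule power_mono) simp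
    then have 2: "(bump c \<rho> b - bump c \<rho> a)\<^sup>2 \<le> (G + C)\<^sup>2 * w\<^sup>2" by (simp add: power_mult_distrib)
    have "C * w\<^sup>2 \<le> M * w powr q" "(G + C)\<^sup>2 * w\<^sup>2 \<le> M * w powr q"
      using pos sq wq by (auto intro!: mult_mono simp: M_def)
    with 1 2 show ?thesis by linarith
  next
    case False
    then have wq: "w \<le> w powr q" "1 \<le> w powr q"
      using powr_mono[of 1 q w] q by auto
    have "\<bar>bump c \<rho> b - bump c \<rho> a - bump_grad c \<rho> a \<bullet> (b - a)\<bar> \<le> 2 * A * 1 + G * w"
      using AA inner by linarith
    also have "\<dots> \<le> 2 * A * w powr q + G * w powr q"
      using wq pos by (intro add_mono mult_left_mono) auto
    also have "\<dots> = (2 * A + G) * w powr q" by (simp add: distrib_right)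
    also have "\<dots> \<le> M * w powr q"
      using pos sq by (intro mult_right_mono) (auto simp: M_def)
    finally have 1: "\<bar>bump c \<rho> b - bump c \<rho> a - bump_grad c \<rho> a \<bullet> (b - a)\<bar> \<le> M * w powr q" .
    have "\<bar>bump c \<rho> b - bump c \<rho> a\<bar>\<^sup>2 \<le> (2 * A)\<^sup>2" using AA by (rule power_mono) simp
    then have "(bump c \<rho> b - bump c \<rho> a)\<^sup>2 \<le> (4 * A\<^sup>2) * 1" by (simp add: power_mult_distrib)
    also have "\<dots> \<le> M * w powr q"
      using pos sq wq by (intro mult_mono) (auto simp: M_def)
    finally show ?thesis using 1 by simp
  qed
  then show "\<bar>bump c \<rho> b - bump c \<rho> a - bump_grad c \<rho> a \<bullet> (b - a)\<bar> \<le> M * norm (b - a) powr q"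
    "(bump c \<rho> b - bump c \<rho> a)\<^sup>2 \<le> M * norm (b - a) powr q"
    by (simp_all add: w_def)
qed

section \<open>Test functions along the limiting vector field\<close>

lemma continuous_on_fluid_field:
  assumes "continuous_on \<O> \<Delta>" "0 \<notin> \<O>"
  shows "continuous_on \<O> (fluid_field \<beta> \<Delta>)"
  unfolding fluid_field_def using assms by (intro continuous_intros) auto

text \<open>The rate of change of \<open>bump\<close> along solutions of the equation with
  right-hand side \<open>h\<close>. Values of \<open>h\<close> off the ball are multiplied by a zero
  gradient.\<close>

definition bump_drift :: "('a::euclidean_space \<Rightarrow> 'a) \<Rightarrow> 'a \<Rightarrow> real \<Rightarrow> 'a \<Rightarrow> real" where
  "bump_drift h c \<rho> y = bump_grad c \<rho> y \<bullet> h y"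

text \<open>Two open sets cover the space: \<open>\<O>\<close>, where \<open>h\<close> is
  continuous, and the complement of the closed ball, where the function is zero.\<close>

lemma continuous_on_bump_drift:
  assumes \<rho>: "0 < \<rho>" and h: "continuous_on \<O> h" "open \<O>" "cball c \<rho> \<subseteq> \<O>"
  shows "continuous_on UNIV (bump_drift h c \<rho>)"
proof -
  have "continuous_on (\<O> \<union> - cball c \<rho>) (bump_drift h c \<rho>)"
  proof (rule continuous_on_open_Un)
    show "continuous_on \<O> (bump_drift h c \<rho>)"
      unfolding bump_drift_def by (intro continuous_intros continuous_on_bump_grad h)
    have "continuous_on (- cball c \<rho>) (\<lambda>_. 0 :: real)" by simp
    then show "continuous_on (- cball c \<rho>) (bump_drift h c \<rho>)"
      by (rule continuous_on_cong[THEN iffD1, rotated 2])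
         (auto simp: bump_drift_def bump_outside \<rho> dist_norm norm_minus_commute)
  qed (use h in \<open>auto simp: open_Compl\<close>)
  moreover have "\<O> \<union> - cball c \<rho> = UNIV" using h by auto
  ultimately show ?thesis by simp
qed

lemma bump_drift_bounded:
  assumes \<rho>: "0 < \<rho>" and h: "continuous_on \<O> h" "open \<O>" "cball c \<rho> \<subseteq> \<O>"
  obtains B where "\<And>y. \<bar>bump_drift h c \<rho> y\<bar> \<le> B"
proof -
  have "compact (bump_drift h c \<rho> ` cball c \<rho>)"
    by (intro compact_continuous_image continuous_on_subset[OF continuous_on_bump_drift[OF assms]]) auto
  then have "bounded (bump_drift h c \<rho> ` cball c \<rho>)" by (rule compact_imp_bounded)
  then obtain B where B: "\<And>y. y \<in> cball c \<rho> \<Longrightarrow> \<bar>bump_drift h c \<rho> y\<bar> \<le> B"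
    unfolding bounded_iff real_norm_def by blast
  have "\<bar>bump_drift h c \<rho> y\<bar> \<le> B" for y
  proof (cases "y \<in> cball c \<rho>")
    case False
    then have "bump_drift h c \<rho> y = 0"
      by (auto simp: bump_drift_def bump_outside \<rho> dist_norm norm_minus_commute)
    moreover have "0 \<le> B" using B[of c] \<rho> by force
    ultimately show ?thesis by simp
  qed (rule B)
  then show ?thesis by (rule that)
qed

text \<open>The integral identity and the fundamental theorem of calculus differentiate
  \<open>bump\<close> along the path. Inside the ball \<open>bump\<close> is positive, so its square
  root can be differentiated, and the squared distance is \<open>\<rho>\<^sup>2\<close> minus that
  root.\<close>

lemma sq_dist_derivative:
  assumes \<rho>: "norm (\<eta> v - c) < \<rho>"
    and h: "continuous_on \<O> h" "open \<O>" "cball c \<rho> \<subseteq> \<O>"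
    and cont: "continuous_on {0..T} \<eta>" and v: "v \<in> {0..T}"
    and int: "\<And>v. 0 \<le> v \<Longrightarrow>
      ((\<lambda>w. bump_drift h c \<rho> (\<eta> w)) has_integral (bump c \<rho> (\<eta> v) - bump c \<rho> (\<eta> 0))) {0..v}"
  shows "((\<lambda>u. (norm (\<eta> u - c))\<^sup>2) has_real_derivative 2 * ((\<eta> v - c) \<bullet> h (\<eta> v))) (at v within {0..T})"
proof -
  have \<rho>0: "0 < \<rho>" using \<rho> norm_ge_zero[of "\<eta> v - c"] by linarith
  define P where "P = \<rho>\<^sup>2 - (norm (\<eta> v - c))\<^sup>2"
  have P: "0 < P" using \<rho> power_strict_mono[of "norm (\<eta> v - c)" \<rho> 2] by (simp add: P_def)
  have "continuous_on {0..T} (\<lambda>w. bump_drift h c \<rho> (\<eta> w))"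
    using continuous_on_compose2[OF continuous_on_bump_drift[OF \<rho>0 h] cont] by auto
  from integral_has_real_derivative[OF this v]
  have "((\<lambda>u. bump c \<rho> (\<eta> 0) + integral {0..u} (\<lambda>w. bump_drift h c \<rho> (\<eta> w)))
      has_real_derivative bump_drift h c \<rho> (\<eta> v)) (at v within {0..T})"
    by (auto intro!: derivative_eq_intros)
  then have 1: "((\<lambda>u. bump c \<rho> (\<eta> u)) has_real_derivative bump_drift h c \<rho> (\<eta> v)) (at v within {0..T})"
    by (rule has_field_derivative_transform_within[OF _ zero_less_one v])
       (use integral_unique[OF int] in auto)
  have bp: "0 < bump c \<rho> (\<eta> v)" using P by (simp add: bump_def flip: P_def)
  have "((\<lambda>u. \<rho>\<^sup>2 - sqrt (bump c \<rho> (\<eta> u))) has_real_derivative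
      - (bump_drift h c \<rho> (\<eta> v) * (inverse (sqrt (bump c \<rho> (\<eta> v))) / 2))) (at v within {0..T})"
    by (rule DERIV_cong[OF DERIV_diff[OF DERIV_const DERIV_chain'[OF 1 DERIV_real_sqrt[OF bp]]]]) simp
  moreover have "- (bump_drift h c \<rho> (\<eta> v) * (inverse (sqrt (bump c \<rho> (\<eta> v))) / 2)) = 2 * ((\<eta> v - c) \<bullet> h (\<eta> v))"
    using P by (simp add: bump_drift_def bump_grad_def bump_def flip: P_def)
  ultimately have 2: "((\<lambda>u. \<rho>\<^sup>2 - sqrt (bump c \<rho> (\<eta> u))) has_real_derivative
      2 * ((\<eta> v - c) \<bullet> h (\<eta> v))) (at v within {0..T})" by simp
  have "continuous_on {0..T} (\<lambda>u. norm (\<eta> u - c))" using cont by (intro continuous_intros)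
  then have "((\<lambda>u. norm (\<eta> u - c)) \<longlongrightarrow> norm (\<eta> v - c)) (at v within {0..T})"
    using v unfolding continuous_on_def by blast
  \<comment> \<open>The square root equals the untruncated difference only inside the ball, where
    the path stays for times close to \<open>v\<close>.\<close>
  then have "\<forall>\<^sub>F u in at v within {0..T}. norm (\<eta> u - c) < \<rho>"
    using \<rho> by (rule order_tendstoD)
  then have "\<forall>\<^sub>F u in at v within {0..T}. \<rho>\<^sup>2 - sqrt (bump c \<rho> (\<eta> u)) = (norm (\<eta> u - c))\<^sup>2"
  proof eventually_elim
    case (elim u)
    then show ?case using power_mono[of "norm (\<eta> u - c)" \<rho> 2] by (simp add: bump_def)
  qed
  moreover have "\<rho>\<^sup>2 - sqrt (bump c \<rho> (\<eta> v)) = (norm (\<eta> v - c))\<^sup>2"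
    using P by (simp add: bump_def P_def)
  ultimately show ?thesis
    by (rule iffD1[OF has_field_derivative_cong_eventually 2])
qed

text \<open>Polarization: the difference of the squared distances to two centres \<open>d\<close>
  and \<open>d + q *\<^sub>R b\<close> is affine in the coordinate along \<open>b\<close>, so every
  coordinate of the path is differentiable. Centres and radii range over a countable family, since
  the identities are available almost surely for one test function at a time.\<close>

lemma fluid_ode:
  fixes \<eta> :: "real \<Rightarrow> 'a::euclidean_space"
  assumes h: "continuous_on \<O> h" "open \<O>"
    and cont: "continuous_on {0..} \<eta>" and s: "0 \<le> s" and su: "s \<le> u"
    and in_O: "\<And>v. v \<in> {s..u} \<Longrightarrow> \<eta> v \<in> \<O>"
    and dense: "\<And>U. open U \<Longrightarrow> U \<noteq> {} \<Longrightarrow> \<exists>d\<in>D. d \<in> U"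
    and int: "\<And>d q b \<rho> c v. d \<in> D \<Longrightarrow> q \<in> \<rat> \<Longrightarrow> b \<in> Basis \<Longrightarrow> \<rho> \<in> \<rat> \<Longrightarrow> 0 < \<rho> \<Longrightarrow> c = d + q *\<^sub>R b \<Longrightarrow>
      cball c \<rho> \<subseteq> \<O> \<Longrightarrow> 0 \<le> v \<Longrightarrow>
      ((\<lambda>w. bump_drift h c \<rho> (\<eta> w)) has_integral (bump c \<rho> (\<eta> v) - bump c \<rho> (\<eta> 0))) {0..v}"
  shows "((\<lambda>v. h (\<eta> v)) has_integral (\<eta> u - \<eta> s)) {s..u}"
proof -
  have deriv: "((\<lambda>w. \<eta> w \<bullet> b) has_real_derivative h (\<eta> v) \<bullet> b) (at v within {0..u})"
    if v: "v \<in> {s..u}" and b: "b \<in> Basis" for v b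
  proof -
    obtain e where e: "0 < e" "ball (\<eta> v) e \<subseteq> \<O>"
      using openE[OF h(2) in_O[OF v]] by blast
    obtain n where n: "1 / Suc n < e" using e(1) nat_approx_posE by blast
    define \<epsilon> :: real where "\<epsilon> = 1 / Suc n"
    have \<epsilon>: "0 < \<epsilon>" "\<epsilon> < e" "\<epsilon> \<in> \<rat>" using n by (auto simp: \<epsilon>_def)
    \<comment> \<open>Any centre within \<open>\<epsilon> / 8\<close> of \<open>d\<close> is closer
      than \<open>\<epsilon> / 4\<close> to the path point. Its ball of radius
      \<open>\<epsilon> / 2\<close> thus contains that point and stays within
      \<open>3 * \<epsilon> / 4\<close> of it, inside \<open>\<O>\<close>. Moreover
      \<open>\<epsilon> / 2\<close> and the shift \<open>\<epsilon> / 8\<close> are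
      rational.\<close>
    obtain d where d: "d \<in> D" "d \<in> ball (\<eta> v) (\<epsilon> / 8)"
      using dense[of "ball (\<eta> v) (\<epsilon> / 8)"] \<epsilon>(1) by (auto simp: ball_eq_empty)
    define q where "q = \<epsilon> / 8"
    define c' where "c' = d + q *\<^sub>R b"
    have dc: "dist d c' = \<epsilon> / 8" using b \<epsilon>(1) by (simp add: c'_def q_def dist_norm)
    have near: "norm (\<eta> v - c) < \<epsilon> / 2" "cball c (\<epsilon> / 2) \<subseteq> \<O>" if "dist d c \<le> \<epsilon> / 8" for c
    proof -
      have "dist (\<eta> v) d < \<epsilon> / 8" using d(2) by simp
      then have *: "dist (\<eta> v) c < \<epsilon> / 4" using that dist_triangle[of "\<eta> v" c d] by linarith
      then show "norm (\<eta> v - c) < \<epsilon> / 2" using \<epsilon>(1) by (simp add: dist_norm)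
      have "cball c (\<epsilon> / 2) \<subseteq> ball (\<eta> v) e"
      proof
        fix y assume "y \<in> cball c (\<epsilon> / 2)"
        then have "dist c y \<le> \<epsilon> / 2" by simp
        with * show "y \<in> ball (\<eta> v) e" using dist_triangle[of "\<eta> v" y c] \<epsilon> by simp
      qed
      then show "cball c (\<epsilon> / 2) \<subseteq> \<O>" using e(2) by blast
    qed
    have cont': "continuous_on {0..u} \<eta>" using cont by (rule continuous_on_subset) auto
    have v': "v \<in> {0..u}" using v s by simp
    have q: "0 < q" "q \<in> \<rat>" using \<epsilon> by (simp_all add: q_def)
    have sq: "((\<lambda>w. (norm (\<eta> w - c))\<^sup>2) has_real_derivative 2 * ((\<eta> v - c) \<bullet> h (\<eta> v))) (at v within {0..u})"
      if c: "c = d + q' *\<^sub>R b" "q' \<in> \<rat>" "dist d c \<le> \<epsilon> / 8" for c q'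
    proof (rule sq_dist_derivative[OF near(1) h near(2) cont' v', OF c(3) c(3)])
      show "((\<lambda>w. bump_drift h c (\<epsilon> / 2) (\<eta> w)) has_integral
          (bump c (\<epsilon> / 2) (\<eta> v) - bump c (\<epsilon> / 2) (\<eta> 0))) {0..v}" if "0 \<le> v" for v
        using \<epsilon> by (intro int[OF d(1) c(2) b _ _ c(1) near(2)[OF c(3)] that]) auto
    qed
    have sqd: "((\<lambda>w. (norm (\<eta> w - d))\<^sup>2) has_real_derivative 2 * ((\<eta> v - d) \<bullet> h (\<eta> v))) (at v within {0..u})"
      \<comment> \<open>The centre \<open>d\<close> itself belongs to the family with shift
        0.\<close>
      using \<epsilon> by (intro sq[of d 0]) auto
    have sqc': "((\<lambda>w. (norm (\<eta> w - c'))\<^sup>2) has_real_derivative 2 * ((\<eta> v - c') \<bullet> h (\<eta> v))) (at v within {0..u})"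
      using q dc by (intro sq[of c' q]) (auto simp: c'_def)
    have "((\<lambda>w. ((norm (\<eta> w - d))\<^sup>2 - (norm (\<eta> w - c'))\<^sup>2) / (2 * q) + (d \<bullet> b + q / 2)) has_real_derivative
        (2 * ((\<eta> v - d) \<bullet> h (\<eta> v)) - 2 * ((\<eta> v - c') \<bullet> h (\<eta> v))) / (2 * q)) (at v within {0..u})"
      by (rule DERIV_cong[OF DERIV_add[OF DERIV_cdivide[OF DERIV_diff[OF sqd sqc']] DERIV_const]]) simp
    moreover have "(2 * ((\<eta> v - d) \<bullet> h (\<eta> v)) - 2 * ((\<eta> v - c') \<bullet> h (\<eta> v))) / (2 * q) = h (\<eta> v) \<bullet> b"
    proof -
      have "(\<eta> v - c') \<bullet> h (\<eta> v) = (\<eta> v - d) \<bullet> h (\<eta> v) - q * (h (\<eta> v) \<bullet> b)"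
        by (simp add: c'_def inner_diff_left inner_add_left inner_commute[of b])
      then show ?thesis using q by simp
    qed
    \<comment> \<open>As \<open>b\<close> is a unit vector, the quotient is
      \<open>(x - d) \<bullet> b - q / 2\<close>; the added constant removes the offset.\<close>
    moreover have "((norm (x - d))\<^sup>2 - (norm (x - c'))\<^sup>2) / (2 * q) + (d \<bullet> b + q / 2) = x \<bullet> b" for x
    proof -
      have "(norm (x - c'))\<^sup>2 = (norm (x - d))\<^sup>2 - 2 * q * ((x - d) \<bullet> b) + q\<^sup>2"
        using b unfolding power2_norm_eq_inner c'_def
        by (simp add: inner_diff_left inner_diff_right inner_add_left inner_add_right inner_commute
            power2_eq_square algebra_simps)
      then show ?thesis using q by (simp add: inner_diff_left power2_eq_square field_simps)
    qed
    ultimately show ?thesis by simp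
  qed
  show ?thesis
  proof (subst has_integral_componentwise_iff, intro ballI)
    fix b :: 'a assume b: "b \<in> Basis"
    have "((\<lambda>v. h (\<eta> v) \<bullet> b) has_integral (\<eta> u \<bullet> b - \<eta> s \<bullet> b)) {s..u}"
    proof (rule fundamental_theorem_of_calculus[OF su])
      fix v assume "v \<in> {s..u}"
      from DERIV_subset[OF deriv[OF this b], of "{s..u}"] s
      show "((\<lambda>w. \<eta> w \<bullet> b) has_vector_derivative h (\<eta> v) \<bullet> b) (at v within {s..u})"
        by (simp add: has_real_derivative_iff_has_vector_derivative)
    qed
    then show "((\<lambda>v. h (\<eta> v) \<bullet> b) has_integral (\<eta> u - \<eta> s) \<bullet> b) {s..u}"
      by (simp add: inner_diff_left)
  qed
qed

section \<open>One-step conditional expectations\<close>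

lemma natural_filtration_generators:
  "{\<Phi> j -` A \<inter> space M | j A. j \<le> k \<and> A \<in> sets borel} \<subseteq> Pow (space M)"
  by auto

lemma space_natural_filtration: "space (natural_filtration M \<Phi> k) = space M"
  unfolding natural_filtration_def by (rule space_measure_of[OF natural_filtration_generators])

lemma sets_natural_filtration:
  "sets (natural_filtration M \<Phi> k) = sigma_sets (space M) {\<Phi> j -` A \<inter> space M | j A. j \<le> k \<and> A \<in> sets borel}"
  unfolding natural_filtration_def by (rule sets_measure_of[OF natural_filtration_generators])

lemma subalgebra_natural_filtration:
  assumes "\<And>j. \<Phi> j \<in> borel_measurable M"
  shows "subalgebra M (natural_filtration M \<Phi> k)"
  unfolding subalgebra_def space_natural_filtration sets_natural_filtration
  using assms by (auto intro!: sets.sigma_sets_subset measurable_sets)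

lemma measurable_natural_filtration:
  assumes "j \<le> k"
  shows "\<Phi> j \<in> borel_measurable (natural_filtration M \<Phi> k)"
proof (rule measurableI)
  fix A :: "'b set" assume "A \<in> sets borel"
  then show "\<Phi> j -` A \<inter> space (natural_filtration M \<Phi> k) \<in> sets (natural_filtration M \<Phi> k)"
    using assms unfolding space_natural_filtration sets_natural_filtration
    by (intro sigma_sets.Basic) auto
qed simp

section \<open>The Markov property for bounded functions\<close>

context
  fixes P :: "'a::euclidean_space \<Rightarrow> 'a measure" and \<Omega> :: "'w measure"
    and Pr :: "'a \<Rightarrow> 'w measure" and \<Phi> :: "nat \<Rightarrow> 'w \<Rightarrow> 'a"
  assumes chain: "markov_chain P \<Omega> Pr \<Phi>"
begin

lemma prob_space_law: "prob_space (Pr x)"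
  using chain by (simp add: markov_chain_def)

lemma measurable_chain: "\<Phi> k \<in> borel_measurable (Pr x)"
  using chain measurable_cong_sets[of "Pr x" \<Omega> borel borel] by (auto simp: markov_chain_def)

lemma AE_initial: "AE \<omega> in Pr x. \<Phi> 0 \<omega> = x"
  using chain by (simp add: markov_chain_def)

lemma measurable_kernel: "P \<in> borel \<rightarrow>\<^sub>M subprob_algebra borel"
  using chain by (auto simp: markov_chain_def intro: measurable_prob_algebraD)

lemma markov_kernel: "prob_space (P y)" "sets (P y) = sets borel" "space (P y) = UNIV"
proof -
  have "P y \<in> space (prob_algebra borel)"
    using chain measurable_space[of P borel "prob_algebra borel" y] by (simp add: markov_chain_def)
  then show "prob_space (P y)" and sets: "sets (P y) = sets borel" by (auto simp: space_prob_algebra)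
  from sets_eq_imp_space_eq[OF sets] show "space (P y) = UNIV" by simp
qed

lemma finite_measure_subalgebra_law:
  "finite_measure_subalgebra (Pr x) (natural_filtration (Pr x) \<Phi> k)"
proof -
  interpret prob_space "Pr x" by (rule prob_space_law)
  show ?thesis
    by unfold_locales (rule subalgebra_natural_filtration, rule measurable_chain)
qed

lemma borel_measurable_kernel_integral:
  fixes \<phi> :: "'a \<Rightarrow> real"
  assumes "\<phi> \<in> borel_measurable borel"
  shows "(\<lambda>y. \<integral>z. \<phi> z \<partial>P y) \<in> borel_measurable borel"
  using measurable_compose[OF measurable_kernel integral_measurable_subprob_algebra[OF assms]] .

lemma abs_kernel_integral_le:
  fixes \<phi> :: "'a \<Rightarrow> real"
  assumes [measurable]: "\<phi> \<in> borel_measurable borel" and "\<And>y. \<bar>\<phi> y\<bar> \<le> C"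
  shows "integrable (P y) \<phi>" "\<bar>\<integral>z. \<phi> z \<partial>P y\<bar> \<le> C"
proof -
  interpret P: prob_space "P y" by (rule markov_kernel)
  have [measurable]: "\<phi> \<in> borel_measurable (P y)"
    using assms(1) measurable_cong_sets[OF markov_kernel(2)] by blast
  show int: "integrable (P y) \<phi>"
    using assms(2) by (intro P.integrable_const_bound[where B = C]) auto
  have "\<bar>\<integral>z. \<phi> z \<partial>P y\<bar> \<le> (\<integral>z. \<bar>\<phi> z\<bar> \<partial>P y)" by (rule integral_abs_bound)
  also have "\<dots> \<le> (\<integral>z. C \<partial>P y)"
    using assms(2) int by (intro integral_mono) auto
  finally show "\<bar>\<integral>z. \<phi> z \<partial>P y\<bar> \<le> C" by (simp add: P.prob_space)
qed

text \<open>The Markov property is assumed for events. On the law restricted to \<open>W\<close> it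
  says that the next state is distributed as the mixture of the kernel; this equality of measures
  gives all bounded \<open>\<phi>\<close> at once.\<close>

lemma markov_set_integral:
  fixes \<phi> :: "'a \<Rightarrow> real"
  assumes W: "W \<in> sets (natural_filtration (Pr x) \<Phi> k)"
    and \<phi>: "\<phi> \<in> borel_measurable borel" "\<And>y. \<bar>\<phi> y\<bar> \<le> C"
  shows "(LINT \<omega>:W|Pr x. \<phi> (\<Phi> (Suc k) \<omega>)) = (LINT \<omega>:W|Pr x. (\<integral>z. \<phi> z \<partial>P (\<Phi> k \<omega>)))"
proof -
  interpret Px: prob_space "Pr x" by (rule prob_space_law)
  interpret finite_measure_subalgebra "Pr x" "natural_filtration (Pr x) \<Phi> k"
    by (rule finite_measure_subalgebra_law)
  note [measurable] = measurable_chain measurable_kernel \<phi>(1)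
  have [measurable]: "W \<in> sets (Pr x)" using W subalg by (auto simp: subalgebra_def)
  define M where "M = density (Pr x) (indicator W)"
  have M_real: "M = density (Pr x) (\<lambda>\<omega>. ennreal (indicator W \<omega>))"
    by (simp add: M_def ennreal_indicator)
  have sets_M [measurable_cong]: "sets M = sets (Pr x)" by (simp add: M_def)
  have space_M: "space M = space (Pr x)" by (simp add: M_def)
  have ne: "space M \<noteq> {}" using Px.not_empty by (simp add: space_M)
  have fin: "finite_measure M"
  proof
    have "emeasure M (space M) = (\<integral>\<^sup>+\<omega>. indicator W \<omega> * indicator (space (Pr x)) \<omega> \<partial>Pr x)"
      unfolding M_def by (subst emeasure_density) auto
    also have "\<dots> = (\<integral>\<^sup>+\<omega>. indicator W \<omega> \<partial>Pr x)" by (rule nn_integral_cong) simp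
    also have "\<dots> = emeasure (Pr x) W" by simp
    finally show "emeasure M (space M) \<noteq> \<infinity>" by simp
  qed
  have K: "(\<lambda>\<omega>. P (\<Phi> k \<omega>)) \<in> M \<rightarrow>\<^sub>M subprob_algebra borel" by measurable
  have "distr M borel (\<Phi> (Suc k)) = M \<bind> (\<lambda>\<omega>. P (\<Phi> k \<omega>))"
  proof (rule measure_eqI)
    show "sets (distr M borel (\<Phi> (Suc k))) = sets (M \<bind> (\<lambda>\<omega>. P (\<Phi> k \<omega>)))"
      using sets_bind[OF _ ne, of "\<lambda>\<omega>. P (\<Phi> k \<omega>)" borel] markov_kernel(2) by simp
    fix A assume "A \<in> sets (distr M borel (\<Phi> (Suc k)))"
    then have A [measurable]: "A \<in> sets borel" by simp
    define I :: "'w \<Rightarrow> real" where "I = indicator (\<Phi> (Suc k) -` A \<inter> space (Pr x))"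
    have I [measurable]: "integrable (Pr x) I"
      unfolding I_def by (simp add: integrable_real_indicator Px.emeasure_eq_measure)
    have int: "integrable (Pr x) (\<lambda>\<omega>. indicator W \<omega> * measure (P (\<Phi> k \<omega>)) A)"
      by (rule Px.integrable_const_bound[where B = 1])
         (auto split: split_indicator simp: prob_space.prob_le_1[OF markov_kernel(1)])
    have "emeasure (distr M borel (\<Phi> (Suc k))) A = (\<integral>\<^sup>+\<omega>. ennreal (indicator W \<omega> * I \<omega>) \<partial>Pr x)"
      unfolding M_def
      by (subst emeasure_distr) (auto simp: emeasure_density I_def intro!: nn_integral_cong split: split_indicator)
    also have "\<dots> = ennreal (\<integral>\<omega>. indicator W \<omega> * I \<omega> \<partial>Pr x)"
      using integrable_mult_indicator[OF \<open>W \<in> sets (Pr x)\<close> I]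
      by (intro nn_integral_eq_integral) (auto simp: I_def)
    \<comment> \<open>As \<open>W\<close> belongs to the past, the indicator of the event may be
      replaced by its conditional expectation, which the Markov property then identifies with the
      kernel.\<close>
    also have "(\<integral>\<omega>. indicator W \<omega> * I \<omega> \<partial>Pr x)
        = (\<integral>\<omega>. indicator W \<omega> * real_cond_exp (Pr x) (natural_filtration (Pr x) \<Phi> k) I \<omega> \<partial>Pr x)"
      using real_cond_exp_intA[OF I W] by (simp add: set_lebesgue_integral_def)
    also have "\<dots> = (\<integral>\<omega>. indicator W \<omega> * measure (P (\<Phi> k \<omega>)) A \<partial>Pr x)"
    proof (rule integral_cong_AE)
      have "AE \<omega> in Pr x. real_cond_exp (Pr x) (natural_filtration (Pr x) \<Phi> k) I \<omega> = measure (P (\<Phi> k \<omega>)) A"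
        unfolding I_def using chain A by (simp add: markov_chain_def)
      then show "AE \<omega> in Pr x. indicator W \<omega> * real_cond_exp (Pr x) (natural_filtration (Pr x) \<Phi> k) I \<omega>
          = indicator W \<omega> * measure (P (\<Phi> k \<omega>)) A" by eventually_elim simp
    qed measurable
    also have "ennreal \<dots> = (\<integral>\<^sup>+\<omega>. ennreal (indicator W \<omega> * measure (P (\<Phi> k \<omega>)) A) \<partial>Pr x)"
      using int by (intro nn_integral_eq_integral[symmetric]) auto
    also have "\<dots> = (\<integral>\<^sup>+\<omega>. indicator W \<omega> * emeasure (P (\<Phi> k \<omega>)) A \<partial>Pr x)"
      by (intro nn_integral_cong)
         (auto split: split_indicator simp: finite_measure.emeasure_eq_measure[OF prob_space.finite_measure[OF markov_kernel(1)]])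
    also have "\<dots> = (\<integral>\<^sup>+\<omega>. emeasure (P (\<Phi> k \<omega>)) A \<partial>M)"
      unfolding M_def
      by (subst nn_integral_density) (auto intro!: measurable_compose[OF _ measurable_emeasure_subprob_algebra[OF A]])
    also have "\<dots> = emeasure (M \<bind> (\<lambda>\<omega>. P (\<Phi> k \<omega>))) A"
      by (rule emeasure_bind[OF ne K A, symmetric])
    finally show "emeasure (distr M borel (\<Phi> (Suc k))) A = emeasure (M \<bind> (\<lambda>\<omega>. P (\<Phi> k \<omega>))) A" .
  qed
  then have "(\<integral>\<omega>. \<phi> (\<Phi> (Suc k) \<omega>) \<partial>M) = (\<integral>z. \<phi> z \<partial>(M \<bind> (\<lambda>\<omega>. P (\<Phi> k \<omega>))))"
    by (subst integral_distr[symmetric, of "\<Phi> (Suc k)" M borel \<phi>]) simp_all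
  also have "\<dots> = (\<integral>\<omega>. (\<integral>z. \<phi> z \<partial>P (\<Phi> k \<omega>)) \<partial>M)"
    by (rule integral_bind[where K = borel and B = C and B' = 1])
       (auto simp: \<phi> K fin ne prob_space.emeasure_space_1[OF markov_kernel(1)])
  finally show ?thesis
    unfolding M_real using borel_measurable_kernel_integral[OF \<phi>(1)]
    by (simp add: integral_density set_lebesgue_integral_def)
qed

text \<open>The set integrals characterize the kernel integral as the conditional expectation of
  \<open>\<phi> (\<Phi> (Suc k))\<close>; a bounded factor measurable with respect to the past can
  then be pulled out.\<close>

lemma markov_expectation:
  fixes \<phi> :: "'a \<Rightarrow> real"
  assumes Z: "Z \<in> borel_measurable (natural_filtration (Pr x) \<Phi> k)" "\<And>\<omega>. \<bar>Z \<omega>\<bar> \<le> B"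
    and \<phi>: "\<phi> \<in> borel_measurable borel" "\<And>y. \<bar>\<phi> y\<bar> \<le> C"
  shows "(\<integral>\<omega>. Z \<omega> * \<phi> (\<Phi> (Suc k) \<omega>) \<partial>Pr x) = (\<integral>\<omega>. Z \<omega> * (\<integral>z. \<phi> z \<partial>P (\<Phi> k \<omega>)) \<partial>Pr x)"
proof -
  interpret Px: prob_space "Pr x" by (rule prob_space_law)
  interpret finite_measure_subalgebra "Pr x" "natural_filtration (Pr x) \<Phi> k"
    by (rule finite_measure_subalgebra_law)
  note [measurable] = measurable_chain \<phi>(1) borel_measurable_kernel_integral[OF \<phi>(1)]
  have [measurable]: "Z \<in> borel_measurable (Pr x)"
    by (rule measurable_from_subalg[OF subalg Z(1)])
  have "AE \<omega> in Pr x. real_cond_exp (Pr x) (natural_filtration (Pr x) \<Phi> k) (\<lambda>\<omega>. \<phi> (\<Phi> (Suc k) \<omega>)) \<omega>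
      = (\<integral>z. \<phi> z \<partial>P (\<Phi> k \<omega>))"
  proof (rule real_cond_exp_charact)
    show "integrable (Pr x) (\<lambda>\<omega>. \<phi> (\<Phi> (Suc k) \<omega>))"
      by (rule Px.integrable_const_bound[where B = C]) (auto simp: \<phi>)
    show "integrable (Pr x) (\<lambda>\<omega>. \<integral>z. \<phi> z \<partial>P (\<Phi> k \<omega>))"
      by (rule Px.integrable_const_bound[where B = C]) (auto simp: abs_kernel_integral_le[OF \<phi>])
    show "(\<lambda>\<omega>. \<integral>z. \<phi> z \<partial>P (\<Phi> k \<omega>)) \<in> borel_measurable (natural_filtration (Pr x) \<Phi> k)"
      by (rule measurable_compose[OF measurable_natural_filtration[OF order_refl]
            borel_measurable_kernel_integral[OF \<phi>(1)]])
  qed (rule markov_set_integral[OF _ \<phi>])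
  then have "(\<integral>\<omega>. Z \<omega> * (\<integral>z. \<phi> z \<partial>P (\<Phi> k \<omega>)) \<partial>Pr x)
      = (\<integral>\<omega>. Z \<omega> * real_cond_exp (Pr x) (natural_filtration (Pr x) \<Phi> k) (\<lambda>\<omega>. \<phi> (\<Phi> (Suc k) \<omega>)) \<omega> \<partial>Pr x)"
    by (intro integral_cong_AE) (measurable, auto)
  also have "\<dots> = (\<integral>\<omega>. Z \<omega> * \<phi> (\<Phi> (Suc k) \<omega>) \<partial>Pr x)"
  proof (rule real_cond_exp_intg(2)[OF _ Z(1)])
    have "\<bar>Z \<omega> * \<phi> (\<Phi> (Suc k) \<omega>)\<bar> \<le> B * C" for \<omega>
      unfolding abs_mult using Z(2)[of \<omega>] \<phi>(2) by (intro mult_mono) auto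
    then show "integrable (Pr x) (\<lambda>\<omega>. Z \<omega> * \<phi> (\<Phi> (Suc k) \<omega>))"
      by (intro Px.integrable_const_bound[where B = "B * C"]) auto
  qed measurable
  finally show ?thesis by simp
qed

text \<open>\<open>S\<close> is a martingale with orthogonal increments, so each step adds just the
  expected conditional variance of \<open>\<phi>\<close>, at most \<open>V\<close>.\<close>

lemma martingale_second_moment:
  fixes \<phi> :: "'a \<Rightarrow> real"
  assumes \<phi>: "\<phi> \<in> borel_measurable borel" "\<And>y. \<bar>\<phi> y\<bar> \<le> C"
    and V: "\<And>y. (\<integral>z. (\<phi> z)\<^sup>2 \<partial>P y) - (\<integral>z. \<phi> z \<partial>P y)\<^sup>2 \<le> V"
  defines "S \<equiv> \<lambda>n \<omega>. \<Sum>k<n. \<phi> (\<Phi> (Suc k) \<omega>) - (\<integral>z. \<phi> z \<partial>P (\<Phi> k \<omega>))"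
  shows "(\<integral>\<omega>. (S n \<omega>)\<^sup>2 \<partial>Pr x) \<le> n * V"
proof -
  interpret Px: prob_space "Pr x" by (rule prob_space_law)
  define K where "K y = (\<integral>z. \<phi> z \<partial>P y)" for y
  define K2 where "K2 y = (\<integral>z. (\<phi> z)\<^sup>2 \<partial>P y)" for y
  have \<phi>2: "(\<lambda>z. (\<phi> z)\<^sup>2) \<in> borel_measurable borel" "\<bar>(\<phi> y)\<^sup>2\<bar> \<le> C\<^sup>2" for y
    using \<phi>(1) power_mono[OF \<phi>(2)[of y], of 2] by auto
  have K [measurable]: "K \<in> borel_measurable borel" and KC: "\<bar>K y\<bar> \<le> C" for y
    unfolding K_def using borel_measurable_kernel_integral[OF \<phi>(1)] abs_kernel_integral_le[OF \<phi>] by auto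
  have [measurable]: "K2 \<in> borel_measurable borel" and K2C: "\<bar>K2 y\<bar> \<le> C\<^sup>2" for y
    unfolding K2_def using borel_measurable_kernel_integral[OF \<phi>2(1)] abs_kernel_integral_le[OF \<phi>2] by auto
  note [measurable] = \<phi>(1) measurable_chain
  have C: "0 \<le> C" using order_trans[OF abs_ge_zero \<phi>(2)] .
  have S: "S n \<omega> = (\<Sum>k<n. \<phi> (\<Phi> (Suc k) \<omega>) - K (\<Phi> k \<omega>))" for n \<omega>
    by (simp add: S_def K_def)
  have S_meas: "S n \<in> borel_measurable (natural_filtration (Pr x) \<Phi> n)" for n
    unfolding S[abs_def]
    by (intro borel_measurable_sum borel_measurable_diff measurable_compose[OF _ \<phi>(1)] measurable_compose[OF _ K]
        measurable_natural_filtration) auto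
  have [measurable]: "S n \<in> borel_measurable (Pr x)" for n
    unfolding S[abs_def] by measurable
  have S_bound: "\<bar>S n \<omega>\<bar> \<le> 2 * C * n" for n \<omega>
  proof -
    have "\<bar>S n \<omega>\<bar> \<le> (\<Sum>k<n. \<bar>\<phi> (\<Phi> (Suc k) \<omega>) - K (\<Phi> k \<omega>)\<bar>)" unfolding S by (rule sum_abs)
    also have "\<dots> \<le> (\<Sum>k<n. 2 * C)"
    proof (rule sum_mono)
      fix k show "\<bar>\<phi> (\<Phi> (Suc k) \<omega>) - K (\<Phi> k \<omega>)\<bar> \<le> 2 * C"
        using \<phi>(2)[of "\<Phi> (Suc k) \<omega>"] KC[of "\<Phi> k \<omega>"] by linarith
    qed
    finally show ?thesis by (simp add: ac_simps)
  qed
  have mult_bound: "integrable (Pr x) (\<lambda>\<omega>. f \<omega> * g \<omega>)"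
    if [measurable]: "f \<in> borel_measurable (Pr x)" "g \<in> borel_measurable (Pr x)"
      and "\<And>\<omega>. \<bar>f \<omega>\<bar> \<le> A" "\<And>\<omega>. \<bar>g \<omega>\<bar> \<le> B" for f g :: "'w \<Rightarrow> real" and A B
  proof -
    have "\<bar>f \<omega> * g \<omega>\<bar> \<le> A * B" for \<omega>
      unfolding abs_mult using that(3)[of \<omega>] that(4) by (intro mult_mono) auto
    then show ?thesis by (intro Px.integrable_const_bound[where B = "A * B"]) auto
  qed
  show ?thesis
  proof (induction n)
    case (Suc n)
    let ?p = "\<lambda>\<omega>. \<phi> (\<Phi> (Suc n) \<omega>)" and ?K = "\<lambda>\<omega>. K (\<Phi> n \<omega>)"
    have int: "integrable (Pr x) (\<lambda>\<omega>. S n \<omega> * S n \<omega>)" "integrable (Pr x) (\<lambda>\<omega>. S n \<omega> * ?p \<omega>)"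
      "integrable (Pr x) (\<lambda>\<omega>. S n \<omega> * ?K \<omega>)" "integrable (Pr x) (\<lambda>\<omega>. ?p \<omega> * ?p \<omega>)"
      "integrable (Pr x) (\<lambda>\<omega>. ?K \<omega> * ?p \<omega>)" "integrable (Pr x) (\<lambda>\<omega>. ?K \<omega> * ?K \<omega>)"
      using S_bound \<phi>(2) KC by (auto intro!: mult_bound)
    have K2_int: "integrable (Pr x) (\<lambda>\<omega>. K2 (\<Phi> n \<omega>))"
      using K2C by (intro Px.integrable_const_bound[where B = "C\<^sup>2"]) auto
    \<comment> \<open>Orthogonality: \<open>S n\<close> depends on the past only, so the cross terms
      cancel. The next two identities compute the second moment of the increment.\<close>
    have 1: "(\<integral>\<omega>. S n \<omega> * ?p \<omega> \<partial>Pr x) = (\<integral>\<omega>. S n \<omega> * ?K \<omega> \<partial>Pr x)"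
      unfolding K_def by (rule markov_expectation[OF S_meas S_bound \<phi>])
    have 2: "(\<integral>\<omega>. ?K \<omega> * ?p \<omega> \<partial>Pr x) = (\<integral>\<omega>. ?K \<omega> * ?K \<omega> \<partial>Pr x)"
      unfolding K_def[of "\<Phi> n _", symmetric]
      using markov_expectation[OF measurable_compose[OF measurable_natural_filtration[OF order_refl] K] KC \<phi>]
      by (simp add: K_def)
    have 3: "(\<integral>\<omega>. ?p \<omega> * ?p \<omega> \<partial>Pr x) = (\<integral>\<omega>. K2 (\<Phi> n \<omega>) \<partial>Pr x)"
      using markov_expectation[where Z = "\<lambda>_. 1" and B = 1, OF _ _ \<phi>2] by (simp add: K2_def power2_eq_square)
    have "(\<integral>\<omega>. (S (Suc n) \<omega>)\<^sup>2 \<partial>Pr x) = (\<integral>\<omega>. S n \<omega> * S n \<omega> + 2 * (S n \<omega> * ?p \<omega>) - 2 * (S n \<omega> * ?K \<omega>)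
        + ?p \<omega> * ?p \<omega> - 2 * (?K \<omega> * ?p \<omega>) + ?K \<omega> * ?K \<omega> \<partial>Pr x)"
      by (rule Bochner_Integration.integral_cong) (simp_all add: S power2_eq_square algebra_simps)
    also have "\<dots> = (\<integral>\<omega>. S n \<omega> * S n \<omega> \<partial>Pr x) + (\<integral>\<omega>. K2 (\<Phi> n \<omega>) \<partial>Pr x) - (\<integral>\<omega>. ?K \<omega> * ?K \<omega> \<partial>Pr x)"
      by (simp add: int 1 2 3)
    also have "\<dots> = (\<integral>\<omega>. (S n \<omega>)\<^sup>2 \<partial>Pr x) + (\<integral>\<omega>. K2 (\<Phi> n \<omega>) - ?K \<omega> * ?K \<omega> \<partial>Pr x)"
      by (simp add: int K2_int power2_eq_square)
    also have "(\<integral>\<omega>. K2 (\<Phi> n \<omega>) - ?K \<omega> * ?K \<omega> \<partial>Pr x) \<le> (\<integral>\<omega>. V \<partial>Pr x)"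
      by (rule integral_mono[OF Bochner_Integration.integrable_diff[OF K2_int int(6)]])
         (use V in \<open>auto simp: K_def K2_def power2_eq_square\<close>)
    finally show ?case using Suc.IH by (simp add: Px.prob_space algebra_simps)
  qed (simp add: S)
qed

end

lemma powr_add_le:
  fixes a b :: real
  assumes "0 \<le> a" "0 \<le> b" "0 \<le> q"
  shows "(a + b) powr q \<le> 2 powr q * (a powr q + b powr q)"
proof -
  have "(a + b) powr q \<le> (2 * max a b) powr q" using assms by (intro powr_mono2) auto
  also have "\<dots> = 2 powr q * (max a b) powr q" using assms by (simp add: powr_mult)
  also have "(max a b) powr q \<le> a powr q + b powr q" by (simp add: max_def)
  finally show ?thesis by simp
qed

section \<open>Law and moments of the first step\<close>

context
  fixes P :: "'a::euclidean_space \<Rightarrow> 'a measure" and \<Omega> :: "'w measure"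
    and Pr :: "'a \<Rightarrow> 'w measure" and \<Phi> :: "nat \<Rightarrow> 'w \<Rightarrow> 'a"
  assumes chain: "markov_chain P \<Omega> Pr \<Phi>"
    and integrable_first: "\<And>y. integrable (Pr y) (\<Phi> 1)"
begin

text \<open>The Markov property at time 0, where the state is almost surely \<open>y\<close>. It
  transfers assumptions stated for \<open>Pr y\<close> to the kernel.\<close>

lemma distr_first_step: "distr (Pr y) borel (\<Phi> 1) = P y"
proof (rule measure_eqI)
  show "sets (distr (Pr y) borel (\<Phi> 1)) = sets (P y)" by (simp add: markov_kernel[OF chain])
  fix A assume "A \<in> sets (distr (Pr y) borel (\<Phi> 1))"
  then have A [measurable]: "A \<in> sets borel" by simp
  interpret Py: prob_space "Pr y" by (rule prob_space_law[OF chain])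
  interpret K: prob_space "P y" by (rule markov_kernel[OF chain])
  note [measurable] = measurable_chain[OF chain] borel_measurable_kernel_integral[OF chain]
  have "(\<integral>\<omega>. indicator A (\<Phi> 1 \<omega>) \<partial>Pr y) = (\<integral>\<omega>. (\<integral>z. indicat_real A z \<partial>P (\<Phi> 0 \<omega>)) \<partial>Pr y)"
    using markov_expectation[OF chain, of "\<lambda>_. 1" y 0 1 "indicat_real A" 1] by simp
  also have "\<dots> = (\<integral>\<omega>. (\<integral>z. indicat_real A z \<partial>P y) \<partial>Pr y)"
  proof (rule integral_cong_AE)
    show "AE \<omega> in Pr y. (\<integral>z. indicat_real A z \<partial>P (\<Phi> 0 \<omega>)) = (\<integral>z. indicat_real A z \<partial>P y)"
      using AE_initial[OF chain] by eventually_elim simp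
  qed measurable
  also have "\<dots> = measure (P y) A" using A by (simp add: Py.prob_space markov_kernel[OF chain])
  also have "(\<integral>\<omega>. indicator A (\<Phi> 1 \<omega>) \<partial>Pr y) = measure (Pr y) (\<Phi> 1 -` A \<inter> space (Pr y))"
  proof -
    have "(\<integral>\<omega>. indicator A (\<Phi> 1 \<omega>) \<partial>Pr y) = (\<integral>\<omega>. indicat_real (\<Phi> 1 -` A \<inter> space (Pr y)) \<omega> \<partial>Pr y)"
      by (rule Bochner_Integration.integral_cong) (auto split: split_indicator)
    then show ?thesis by simp
  qed
  finally show "emeasure (distr (Pr y) borel (\<Phi> 1)) A = emeasure (P y) A"
    by (simp add: emeasure_distr Py.emeasure_eq_measure K.emeasure_eq_measure)
qed

lemma kernel_integrable: "integrable (P y) (\<lambda>z. z)"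
  and kernel_mean: "(\<integral>z. z \<partial>P y) = (\<integral>\<omega>. \<Phi> 1 \<omega> \<partial>Pr y)"
  using integrable_first[of y] measurable_chain[OF chain, of 1 y]
  unfolding distr_first_step[of y, symmetric]
  by (simp_all add: integrable_distr_eq integral_distr)

lemma drift_eq_kernel: "drift Pr \<Phi> y = (\<integral>z. z - y \<partial>P y)"
proof -
  interpret K: prob_space "P y" by (rule markov_kernel[OF chain])
  show ?thesis by (simp add: drift_def kernel_integrable kernel_mean K.prob_space)
qed

text \<open>Under \<open>Pr y\<close> the initial \<open>\<sigma>\<close>-algebra is trivial, so conditioning on it is taking expectations.\<close>

lemma innovation_first_step:
  "AE \<omega> in Pr y. innovation (Pr y) \<Phi> 1 \<omega> = \<Phi> 1 \<omega> - (\<integral>\<omega>. \<Phi> 1 \<omega> \<partial>Pr y)"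
proof -
  interpret Py: prob_space "Pr y" by (rule prob_space_law[OF chain])
  let ?F = "natural_filtration (Pr y) \<Phi> 0"
  interpret finite_measure_subalgebra "Pr y" ?F
    by (rule finite_measure_subalgebra_law[OF chain])
  note [measurable] = measurable_chain[OF chain]
  \<comment> \<open>A zero-one law by induction over the generated sets: a generator is decided by
    whether \<open>y\<close> lies in the underlying Borel set, and complements and countable unions
    preserve the dichotomy.\<close>
  have trivial: "(AE \<omega> in Pr y. \<omega> \<in> A) \<or> (AE \<omega> in Pr y. \<omega> \<notin> A)" if "A \<in> sets ?F" for A
    using that unfolding sets_natural_filtration
  proof (induction rule: sigma_sets.induct)
    case (Basic A)
    then obtain B where A: "A = \<Phi> 0 -` B \<inter> space (Pr y)" by auto
    have "AE \<omega> in Pr y. \<omega> \<in> A \<longleftrightarrow> y \<in> B"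
      using AE_initial[OF chain, of y] AE_space by eventually_elim (auto simp: A)
    then show ?case by (cases "y \<in> B") auto
  next
    case (Compl A)
    have "(AE \<omega> in Pr y. \<omega> \<in> space (Pr y) - A) \<longleftrightarrow> (AE \<omega> in Pr y. \<omega> \<notin> A)"
      by (rule AE_cong) simp
    with Compl.IH show ?case by auto
  next
    case (Union A)
    show ?case
    proof (cases "\<exists>i. AE \<omega> in Pr y. \<omega> \<in> A i")
      case True
      then show ?thesis by (auto elim: eventually_mono)
    next
      case False
      with Union.IH have "\<forall>i. AE \<omega> in Pr y. \<omega> \<notin> A i" by blast
      then show ?thesis by (simp add: AE_all_countable)
    qed
  qed simp
  let ?m = "\<integral>\<omega>. \<Phi> 1 \<omega> \<partial>Pr y"
  have "AE \<omega> in Pr y. real_cond_exp (Pr y) ?F (\<lambda>\<omega>. \<Phi> 1 \<omega> \<bullet> b) \<omega> = ?m \<bullet> b" for b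
  proof (rule real_cond_exp_charact)
    fix A assume A: "A \<in> sets ?F"
    then have [measurable]: "A \<in> sets (Pr y)" using subalg by (auto simp: subalgebra_def)
    have mean: "(\<integral>\<omega>. \<Phi> 1 \<omega> \<bullet> b \<partial>Pr y) = (\<integral>\<omega>. ?m \<bullet> b \<partial>Pr y)"
      using integrable_first[of y] by (simp add: Py.prob_space)
    from trivial[OF A] show "(LINT \<omega>:A|Pr y. \<Phi> 1 \<omega> \<bullet> b) = (LINT \<omega>:A|Pr y. ?m \<bullet> b)"
    proof
      assume "AE \<omega> in Pr y. \<omega> \<in> A"
      then have "(LINT \<omega>:A|Pr y. f \<omega>) = (\<integral>\<omega>. f \<omega> \<partial>Pr y)" if [measurable]: "f \<in> borel_measurable (Pr y)" for f :: "'w \<Rightarrow> real"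
        unfolding set_lebesgue_integral_def
        by (intro integral_cong_AE) (auto elim!: eventually_mono)
      then show ?thesis using mean by simp
    next
      assume "AE \<omega> in Pr y. \<omega> \<notin> A"
      then have "(LINT \<omega>:A|Pr y. f \<omega>) = (\<integral>\<omega>. 0 \<partial>Pr y)" if [measurable]: "f \<in> borel_measurable (Pr y)" for f :: "'w \<Rightarrow> real"
        unfolding set_lebesgue_integral_def
        by (intro integral_cong_AE) (auto elim!: eventually_mono)
      then show ?thesis by simp
    qed
  qed (use integrable_first[of y] in auto)
  then have "AE \<omega> in Pr y. \<forall>b\<in>Basis. real_cond_exp (Pr y) ?F (\<lambda>\<omega>. \<Phi> 1 \<omega> \<bullet> b) \<omega> = ?m \<bullet> b"
    by (intro AE_finite_allI) auto
  then show ?thesis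
    by eventually_elim (simp add: innovation_def vec_cond_exp_def euclidean_representation)
qed

lemma drift_bounded:
  assumes "cond_B2 Pr \<Phi> p \<beta>"
  obtains N where "0 \<le> N" "\<And>y. norm (drift Pr \<Phi> y) \<le> N"
proof -
  have fin: "drift_bound \<beta> (drift Pr \<Phi>) < \<infinity>" using assms by (simp add: cond_B2_def)
  have "norm (drift Pr \<Phi> y) \<le> enn2real (drift_bound \<beta> (drift Pr \<Phi>))" for y
  proof -
    have "ennreal ((1 + norm y powr \<beta>) * norm (drift Pr \<Phi> y)) \<le> drift_bound \<beta> (drift Pr \<Phi>)"
      unfolding drift_bound_def by (rule SUP_upper) simp
    then have "(1 + norm y powr \<beta>) * norm (drift Pr \<Phi> y) \<le> enn2real (drift_bound \<beta> (drift Pr \<Phi>))"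
      using fin enn2real_mono by fastforce
    then show ?thesis
      by (rule order_trans[rotated]) (simp add: distrib_right)
  qed
  then show ?thesis by (rule that[rotated]) simp
qed

text \<open>The displacement is the innovation plus the bounded drift. (B1) bounds the tail of the
  innovation beyond a single level \<open>K\<close> uniformly in the starting point, and below
  \<open>K\<close> nothing has to be estimated.\<close>

lemma kernel_moment:
  assumes B1: "cond_B1 Pr \<Phi> p" and B2: "cond_B2 Pr \<Phi> p \<beta>" and q: "0 < q" "q \<le> p"
  obtains C where "0 \<le> C" "\<And>y. integrable (P y) (\<lambda>z. norm (z - y) powr q)"
    "\<And>y. (\<integral>z. norm (z - y) powr q \<partial>P y) \<le> C"
proof -
  obtain N where N: "0 \<le> N" "\<And>y. norm (drift Pr \<Phi> y) \<le> N"
    using drift_bounded[OF B2] by blast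
  define tail where "tail K = (\<Squnion>x. \<integral>\<^sup>+\<omega>. ennreal (norm (innovation (Pr x) \<Phi> 1 \<omega>) powr p) *
      indicator {\<omega>. norm (innovation (Pr x) \<Phi> 1 \<omega>) \<ge> K} \<omega> \<partial>Pr x)" for K :: real
  have "(tail \<longlongrightarrow> 0) at_top" using B1 unfolding cond_B1_def tail_def by simp
  then have "\<forall>\<^sub>F K in at_top. tail K < 1" by (rule order_tendstoD) simp
  \<comment> \<open>With \<open>1 \<le> K\<close> the power \<open>q\<close> is dominated by the
    power \<open>p\<close> on the tail.\<close>
  then have "\<forall>\<^sub>F K in at_top. tail K < 1 \<and> 1 \<le> K" using eventually_ge_at_top[of 1] by eventually_elim simp
  then obtain K where K: "tail K < 1" "1 \<le> K"
    using eventually_happens'[of "at_top :: real filter"] trivial_limit_at_top_linorder by blast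
  \<comment> \<open>The three summands bound the tail, the innovation below level \<open>K\<close>,
    and the drift.\<close>
  define C where "C = 2 powr q * (1 + K powr q + N powr q)"
  have C: "0 \<le> C" by (simp add: C_def)
  have bound: "(\<integral>\<^sup>+z. ennreal (norm (z - y) powr q) \<partial>P y) \<le> ennreal C" for y
  proof -
    interpret Py: prob_space "Pr y" by (rule prob_space_law[OF chain])
    note [measurable] = measurable_chain[OF chain]
    define e where "e \<omega> = norm (\<Phi> 1 \<omega> - (\<integral>\<omega>. \<Phi> 1 \<omega> \<partial>Pr y))" for \<omega>
    have [measurable]: "e \<in> borel_measurable (Pr y)" unfolding e_def[abs_def] by measurable
    define tl where "tl \<omega> = (if K \<le> e \<omega> then e \<omega> powr p else 0)" for \<omega>
    have "(\<integral>\<^sup>+\<omega>. ennreal (tl \<omega>) \<partial>Pr y) = (\<integral>\<^sup>+\<omega>. ennreal (norm (innovation (Pr y) \<Phi> 1 \<omega>) powr p) *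
      indicator {\<omega>. norm (innovation (Pr y) \<Phi> 1 \<omega>) \<ge> K} \<omega> \<partial>Pr y)"
      by (rule nn_integral_cong_AE, use innovation_first_step[of y] in eventually_elim) (simp add: tl_def e_def)
    also have "\<dots> \<le> tail K" unfolding tail_def by (rule SUP_upper) simp
    also have "\<dots> \<le> 1" using K by simp
    finally have tl: "(\<integral>\<^sup>+\<omega>. ennreal (tl \<omega>) \<partial>Pr y) \<le> 1" .
    have "(\<integral>\<^sup>+z. ennreal (norm (z - y) powr q) \<partial>P y) = (\<integral>\<^sup>+\<omega>. ennreal (norm (\<Phi> 1 \<omega> - y) powr q) \<partial>Pr y)"
      unfolding distr_first_step[of y, symmetric] by (subst nn_integral_distr) auto
    also have "\<dots> \<le> (\<integral>\<^sup>+\<omega>. ennreal (2 powr q) * ennreal (tl \<omega>) + ennreal (2 powr q * (K powr q + N powr q)) \<partial>Pr y)"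
    proof (rule nn_integral_mono)
      fix \<omega>
      have "norm (\<Phi> 1 \<omega> - y) = norm ((\<Phi> 1 \<omega> - (\<integral>\<omega>. \<Phi> 1 \<omega> \<partial>Pr y)) + drift Pr \<Phi> y)"
        by (simp add: drift_def)
      also have "\<dots> \<le> e \<omega> + N" unfolding e_def by (rule norm_triangle_mono) (auto simp: N)
      finally have "norm (\<Phi> 1 \<omega> - y) powr q \<le> (e \<omega> + N) powr q"
        using q by (intro powr_mono2) auto
      also have "\<dots> \<le> 2 powr q * (e \<omega> powr q + N powr q)"
        using q N by (intro powr_add_le) (auto simp: e_def)
      also have "e \<omega> powr q \<le> tl \<omega> + K powr q"
      proof (cases "K \<le> e \<omega>")
        case True
        then have "e \<omega> powr q \<le> e \<omega> powr p" using K q by (intro powr_mono) auto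
        with True show ?thesis by (simp add: tl_def add_increasing2)
      next
        case False
        then show ?thesis using q by (simp add: tl_def e_def powr_mono2)
      qed
      finally have "norm (\<Phi> 1 \<omega> - y) powr q \<le> 2 powr q * tl \<omega> + 2 powr q * (K powr q + N powr q)"
        by (simp add: algebra_simps)
      moreover have "0 \<le> tl \<omega>" by (simp add: tl_def)
      ultimately show "ennreal (norm (\<Phi> 1 \<omega> - y) powr q)
          \<le> ennreal (2 powr q) * ennreal (tl \<omega>) + ennreal (2 powr q * (K powr q + N powr q))"
        by (simp add: ennreal_leI flip: ennreal_mult ennreal_plus)
    qed
    also have "\<dots> = ennreal (2 powr q) * (\<integral>\<^sup>+\<omega>. ennreal (tl \<omega>) \<partial>Pr y) + ennreal (2 powr q * (K powr q + N powr q))"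
      unfolding tl_def by (simp add: nn_integral_add nn_integral_cmult Py.emeasure_space_1)
    also have "\<dots> \<le> ennreal (2 powr q) * 1 + ennreal (2 powr q * (K powr q + N powr q))"
      by (intro add_mono mult_left_mono tl) auto
    also have "\<dots> = ennreal C"
      by (simp add: C_def algebra_simps flip: ennreal_plus)
    finally show ?thesis .
  qed
  have int: "integrable (P y) (\<lambda>z. norm (z - y) powr q)" for y
  proof (rule integrableI_nonneg)
    show "(\<lambda>z. norm (z - y) powr q) \<in> borel_measurable (P y)"
      by (subst measurable_cong_sets[OF markov_kernel(2)[OF chain] refl]) measurable
    show "(\<integral>\<^sup>+z. ennreal (norm (z - y) powr q) \<partial>P y) < \<infinity>"
      using bound[of y] by (simp add: order_le_less_trans)
  qed simp
  show ?thesis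
  proof (rule that[OF C int])
    fix y
    have "ennreal (\<integral>z. norm (z - y) powr q \<partial>P y) \<le> ennreal C"
      using bound[of y] int[of y] by (subst nn_integral_eq_integral[symmetric]) auto
    then show "(\<integral>z. norm (z - y) powr q \<partial>P y) \<le> C" using C by simp
  qed
qed

text \<open>After rescaling, one step has \<open>q\<close>-th moment at most
  \<open>C * r powr (- q)\<close>. The first-order expansion of \<open>F\<close> integrates to the
  drift term, with a remainder of this order.\<close>

lemma one_step_estimates:
  fixes F :: "'a \<Rightarrow> real" and D :: "'a \<Rightarrow> 'a"
  assumes F [measurable]: "F \<in> borel_measurable borel" and F_bound: "\<And>y. \<bar>F y\<bar> \<le> M"
    and first: "\<And>a b. \<bar>F b - F a - D a \<bullet> (b - a)\<bar> \<le> M * norm (b - a) powr q"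
    and sq: "\<And>a b. (F b - F a)\<^sup>2 \<le> M * norm (b - a) powr q"
    and int: "\<And>y. integrable (P y) (\<lambda>z. norm (z - y) powr q)"
    and moment: "\<And>y. (\<integral>z. norm (z - y) powr q \<partial>P y) \<le> C"
    and r: "0 < r"
  shows "(\<integral>z. (F ((1 / r) *\<^sub>R z))\<^sup>2 \<partial>P y) - (\<integral>z. F ((1 / r) *\<^sub>R z) \<partial>P y)\<^sup>2 \<le> M * C * r powr (- q)"
    and "\<bar>(\<integral>z. F ((1 / r) *\<^sub>R z) \<partial>P y) - F ((1 / r) *\<^sub>R y) - D ((1 / r) *\<^sub>R y) \<bullet> drift Pr \<Phi> y / r\<bar>
           \<le> M * C * r powr (- q)"
proof -
  interpret K: prob_space "P y" by (rule markov_kernel[OF chain])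
  have M: "0 \<le> M" using order_trans[OF abs_ge_zero F_bound] .
  define f where "f z = F ((1 / r) *\<^sub>R z)" for z
  have f_meas: "f \<in> borel_measurable borel" unfolding f_def[abs_def] by measurable
  have f_bound: "\<bar>f z\<bar> \<le> M" for z by (simp add: f_def F_bound)
  have f2_meas: "(\<lambda>z. (f z)\<^sup>2) \<in> borel_measurable borel" and f2_bound: "\<bar>(f z)\<^sup>2\<bar> \<le> M\<^sup>2" for z
    using f_meas power_mono[OF f_bound[of z], of 2] by auto
  have intf: "integrable (P y) f" "integrable (P y) (\<lambda>z. (f z)\<^sup>2)"
    using abs_kernel_integral_le(1)[OF chain f_meas f_bound] abs_kernel_integral_le(1)[OF chain f2_meas f2_bound] by auto
  have norm_scale: "norm ((1 / r) *\<^sub>R z - (1 / r) *\<^sub>R y) powr q = r powr (- q) * norm (z - y) powr q" for z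
  proof -
    have "(1 / r) *\<^sub>R z - (1 / r) *\<^sub>R y = (1 / r) *\<^sub>R (z - y)" by (simp add: scaleR_diff_right)
    then have "norm ((1 / r) *\<^sub>R z - (1 / r) *\<^sub>R y) = (1 / r) * norm (z - y)" using r by simp
    then have "norm ((1 / r) *\<^sub>R z - (1 / r) *\<^sub>R y) powr q = (1 / r) powr q * norm (z - y) powr q"
      using r by (simp only: powr_mult)
    then show ?thesis using r by (simp add: powr_divide powr_minus inverse_eq_divide)
  qed
  have int_bound: "integrable (P y) (\<lambda>z. M * (r powr (- q) * norm (z - y) powr q))"
    using int by simp
  have int_le: "(\<integral>z. M * (r powr (- q) * norm (z - y) powr q) \<partial>P y) \<le> M * C * r powr (- q)"
    using mult_left_mono[OF mult_left_mono[OF moment[of y], of "r powr (- q)"] M] by (simp add: ac_simps)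
  have int_sq: "integrable (P y) (\<lambda>z. (f z - f y)\<^sup>2)"
    using intf by (simp add: power2_diff)
  \<comment> \<open>The variance is at most the mean square deviation from any constant, here the
    value before the step.\<close>
  have "(\<integral>z. (f z)\<^sup>2 \<partial>P y) - (\<integral>z. f z \<partial>P y)\<^sup>2 = (\<integral>z. (f z - f y)\<^sup>2 \<partial>P y) - ((\<integral>z. f z \<partial>P y) - f y)\<^sup>2"
    using intf by (simp add: power2_diff K.prob_space)
  also have "\<dots> \<le> (\<integral>z. (f z - f y)\<^sup>2 \<partial>P y)" by simp
  also have "\<dots> \<le> (\<integral>z. M * (r powr (- q) * norm (z - y) powr q) \<partial>P y)"
    using sq[of "(1 / r) *\<^sub>R _" "(1 / r) *\<^sub>R y"]
    by (intro integral_mono int_bound int_sq) (simp add: f_def norm_scale[symmetric])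
  also note int_le
  finally show "(\<integral>z. (F ((1 / r) *\<^sub>R z))\<^sup>2 \<partial>P y) - (\<integral>z. F ((1 / r) *\<^sub>R z) \<partial>P y)\<^sup>2 \<le> M * C * r powr (- q)"
    by (simp add: f_def[abs_def])
  have lin: "integrable (P y) (\<lambda>z. D ((1 / r) *\<^sub>R y) \<bullet> (z - y) / r)"
    using kernel_integrable[of y] by simp
  have "(\<integral>z. D ((1 / r) *\<^sub>R y) \<bullet> (z - y) / r \<partial>P y) = D ((1 / r) *\<^sub>R y) \<bullet> drift Pr \<Phi> y / r"
    unfolding drift_eq_kernel using kernel_integrable[of y] by simp
  then have "(\<integral>z. f z \<partial>P y) - f y - D ((1 / r) *\<^sub>R y) \<bullet> drift Pr \<Phi> y / r
      = (\<integral>z. f z - f y - D ((1 / r) *\<^sub>R y) \<bullet> (z - y) / r \<partial>P y)"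
    using intf lin by (auto simp: K.prob_space)
  also have "\<bar>\<dots>\<bar> \<le> (\<integral>z. \<bar>f z - f y - D ((1 / r) *\<^sub>R y) \<bullet> (z - y) / r\<bar> \<partial>P y)"
    by (rule integral_abs_bound)
  also have "\<dots> \<le> (\<integral>z. M * (r powr (- q) * norm (z - y) powr q) \<partial>P y)"
  proof (intro integral_mono int_bound)
    show "integrable (P y) (\<lambda>z. \<bar>f z - f y - D ((1 / r) *\<^sub>R y) \<bullet> (z - y) / r\<bar>)"
      using intf lin by simp
    show "\<bar>f z - f y - D ((1 / r) *\<^sub>R y) \<bullet> (z - y) / r\<bar> \<le> M * (r powr (- q) * norm (z - y) powr q)" for z
    proof -
      have "D ((1 / r) *\<^sub>R y) \<bullet> ((1 / r) *\<^sub>R z - (1 / r) *\<^sub>R y) = D ((1 / r) *\<^sub>R y) \<bullet> (z - y) / r"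
        by (simp flip: scaleR_diff_right)
      then show ?thesis
        using first[where a = "(1 / r) *\<^sub>R y" and b = "(1 / r) *\<^sub>R z"] by (simp only: f_def norm_scale)
    qed
  qed
  also note int_le
  finally show "\<bar>(\<integral>z. F ((1 / r) *\<^sub>R z) \<partial>P y) - F ((1 / r) *\<^sub>R y) - D ((1 / r) *\<^sub>R y) \<bullet> drift Pr \<Phi> y / r\<bar>
      \<le> M * C * r powr (- q)"
    by (simp add: f_def[abs_def])
qed

end

section \<open>The defect of the rescaled chain\<close>

lemma scaled_path_eq_step_path:
  "scaled_path \<Phi> \<beta> r \<omega> = step_path r (r powr (1 + \<beta>)) (\<lambda>k. \<Phi> k \<omega>)"
  by (simp add: scaled_path_def step_path_def)

context
  fixes P :: "'a::euclidean_space \<Rightarrow> 'a measure" and \<Omega> :: "'w measure"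
    and Pr :: "'a \<Rightarrow> 'w measure" and \<Phi> :: "nat \<Rightarrow> 'w \<Rightarrow> 'a"
    and F g :: "'a \<Rightarrow> real" and M V W r c :: real
  assumes chain: "markov_chain P \<Omega> Pr \<Phi>"
    and F_cont: "continuous_on UNIV F" and g_cont: "continuous_on UNIV g"
    and F_bound: "\<And>y. \<bar>F y\<bar> \<le> M" and g_bound: "\<And>y. \<bar>g y\<bar> \<le> M"
    and r: "0 < r" and c: "0 < c"
    and var: "\<And>y. (\<integral>z. (F ((1 / r) *\<^sub>R z))\<^sup>2 \<partial>P y) - (\<integral>z. F ((1 / r) *\<^sub>R z) \<partial>P y)\<^sup>2 \<le> V"
    and drift_error: "\<And>y. \<bar>(\<integral>z. F ((1 / r) *\<^sub>R z) \<partial>P y) - F ((1 / r) *\<^sub>R y) - g ((1 / r) *\<^sub>R y) / c\<bar> \<le> W"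
begin

text \<open>Doob decomposition: the discrete defect is the martingale \<open>S\<close> plus the sum
  \<open>R\<close> of the one-step drift errors. The first is bounded in mean through its second
  moment, the second pointwise.\<close>

lemma expected_discrete_defect_le:
  "(\<integral>\<omega>. \<bar>F ((1 / r) *\<^sub>R \<Phi> n \<omega>) - F ((1 / r) *\<^sub>R \<Phi> 0 \<omega>) - (\<Sum>k<n. g ((1 / r) *\<^sub>R \<Phi> k \<omega>)) / c\<bar> \<partial>Pr x)
     \<le> sqrt (n * V) + n * W"
proof -
  interpret Px: prob_space "Pr x" by (rule prob_space_law[OF chain])
  define f where "f z = F ((1 / r) *\<^sub>R z)" for z
  define K where "K y = (\<integral>z. f z \<partial>P y)" for y
  define S where "S \<omega> = (\<Sum>k<n. f (\<Phi> (Suc k) \<omega>) - K (\<Phi> k \<omega>))" for \<omega>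
  define R where "R \<omega> = (\<Sum>k<n. K (\<Phi> k \<omega>) - f (\<Phi> k \<omega>) - g ((1 / r) *\<^sub>R \<Phi> k \<omega>) / c)" for \<omega>
  have [measurable]: "F \<in> borel_measurable borel" "g \<in> borel_measurable borel"
    using F_cont g_cont by (auto intro: borel_measurable_continuous_onI)
  note [measurable] = measurable_chain[OF chain]
  have f [measurable]: "f \<in> borel_measurable borel" unfolding f_def[abs_def] by measurable
  have f_bound: "\<bar>f y\<bar> \<le> M" for y by (simp add: f_def F_bound)
  have [measurable]: "K \<in> borel_measurable borel" and K_bound: "\<bar>K y\<bar> \<le> M" for y
    unfolding K_def using borel_measurable_kernel_integral[OF chain f] abs_kernel_integral_le[OF chain f f_bound] by auto
  have [measurable]: "S \<in> borel_measurable (Pr x)" "R \<in> borel_measurable (Pr x)"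
    unfolding S_def[abs_def] R_def[abs_def] by measurable
  have S_bound: "\<bar>S \<omega>\<bar> \<le> n * (2 * M)" for \<omega>
  proof -
    have "\<bar>S \<omega>\<bar> \<le> (\<Sum>k<n. \<bar>f (\<Phi> (Suc k) \<omega>) - K (\<Phi> k \<omega>)\<bar>)" unfolding S_def by (rule sum_abs)
    also have "\<dots> \<le> of_nat (card {..<n}) * (2 * M)"
      by (rule sum_bounded_above) (use abs_triangle_ineq4 f_bound K_bound in \<open>smt (verit)\<close>)
    finally show ?thesis by simp
  qed
  have R_bound: "\<bar>R \<omega>\<bar> \<le> n * W" for \<omega>
  proof -
    have "\<bar>R \<omega>\<bar> \<le> (\<Sum>k<n. \<bar>K (\<Phi> k \<omega>) - f (\<Phi> k \<omega>) - g ((1 / r) *\<^sub>R \<Phi> k \<omega>) / c\<bar>)"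
      unfolding R_def by (rule sum_abs)
    also have "\<dots> \<le> of_nat (card {..<n}) * W"
      by (rule sum_bounded_above) (use drift_error in \<open>simp add: K_def f_def\<close>)
    finally show ?thesis by simp
  qed
  have S_int: "integrable (Pr x) S"
    using S_bound by (intro Px.integrable_const_bound[where B = "n * (2 * M)"]) auto
  have S2_int: "integrable (Pr x) (\<lambda>\<omega>. \<bar>S \<omega>\<bar>\<^sup>2)"
    using power_mono[OF S_bound abs_ge_zero, where n = 2]
    by (intro Px.integrable_const_bound[where B = "(n * (2 * M))\<^sup>2"]) auto
  \<comment> \<open>Nonnegativity of this variance is the Cauchy-Schwarz bound of the mean of
    \<open>\<bar>S\<bar>\<close> by the root of its second moment.\<close>
  have "0 \<le> Px.variance (\<lambda>\<omega>. \<bar>S \<omega>\<bar>)" by (rule Px.variance_positive)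
  also have "\<dots> = (\<integral>\<omega>. \<bar>S \<omega>\<bar>\<^sup>2 \<partial>Pr x) - (\<integral>\<omega>. \<bar>S \<omega>\<bar> \<partial>Pr x)\<^sup>2"
    using S_int S2_int by (intro Px.variance_eq) auto
  also have "(\<integral>\<omega>. \<bar>S \<omega>\<bar>\<^sup>2 \<partial>Pr x) \<le> n * V"
    using martingale_second_moment[OF chain f f_bound, where V = V and n = n and x = x] var
    by (simp add: S_def K_def f_def)
  finally have ES: "(\<integral>\<omega>. \<bar>S \<omega>\<bar> \<partial>Pr x) \<le> sqrt (n * V)"
    by (intro real_le_rsqrt) simp
  have eq: "F ((1 / r) *\<^sub>R \<Phi> n \<omega>) - F ((1 / r) *\<^sub>R \<Phi> 0 \<omega>) - (\<Sum>k<n. g ((1 / r) *\<^sub>R \<Phi> k \<omega>)) / c = S \<omega> + R \<omega>" for \<omega>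
  proof -
    have "S \<omega> + R \<omega> = (\<Sum>k<n. f (\<Phi> (Suc k) \<omega>) - f (\<Phi> k \<omega>)) - (\<Sum>k<n. g ((1 / r) *\<^sub>R \<Phi> k \<omega>) / c)"
      unfolding S_def R_def by (simp add: sum_subtractf)
    also have "(\<Sum>k<n. f (\<Phi> (Suc k) \<omega>) - f (\<Phi> k \<omega>)) = f (\<Phi> n \<omega>) - f (\<Phi> 0 \<omega>)"
      by (rule sum_lessThan_telescope)
    finally show ?thesis by (simp add: f_def sum_divide_distrib)
  qed
  have R_int: "integrable (Pr x) R"
    using R_bound by (intro Px.integrable_const_bound[where B = "n * W"]) auto
  have "(\<integral>\<omega>. \<bar>S \<omega> + R \<omega>\<bar> \<partial>Pr x) \<le> (\<integral>\<omega>. \<bar>S \<omega>\<bar> + n * W \<partial>Pr x)"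
  proof (rule integral_mono)
    show "\<bar>S \<omega> + R \<omega>\<bar> \<le> \<bar>S \<omega>\<bar> + n * W" for \<omega>
      using R_bound[of \<omega>] by linarith
  qed (use S_int R_int in auto)
  also have "\<dots> = (\<integral>\<omega>. \<bar>S \<omega>\<bar> \<partial>Pr x) + n * W" using S_int by (simp add: Px.prob_space)
  finally show ?thesis unfolding eq using ES by simp
qed

text \<open>By Fubini it suffices to bound the expected defect at each fixed time. There at most
  \<open>T * c\<close> steps have been made, and the unfinished step costs
  \<open>M / c\<close>.\<close>

lemma expected_total_defect_le:
  assumes T: "0 \<le> T"
  shows "(\<integral>\<omega>. total_defect F g T (step_path r c (\<lambda>k. \<Phi> k \<omega>)) \<partial>Pr x)
           \<le> (sqrt (T * c * V) + T * c * W + M / c) * T"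
proof -
  interpret Px: prob_space "Pr x" by (rule prob_space_law[OF chain])
  interpret pair_sigma_finite "Pr x" lborel ..
  note [measurable] = measurable_chain[OF chain]
  have Fg [measurable]: "F \<in> borel_measurable borel" "g \<in> borel_measurable borel"
    using F_cont g_cont by (auto intro: borel_measurable_continuous_onI)
  define X where "X \<omega> = step_path r c (\<lambda>k. \<Phi> k \<omega>)" for \<omega>
  define Y where "Y \<omega> v = (1 / r) *\<^sub>R \<Phi> (nat \<lfloor>v * c\<rfloor>) \<omega>" for \<omega> and v :: real
  \<comment> \<open>A jointly measurable version of the defect, free of the restriction to
    nonnegative times; both agree for \<open>0 \<le> v\<close>.\<close>
  define pd where "pd \<omega> v = F (Y \<omega> v) - F (Y \<omega> 0) - (\<integral>w. (if 0 \<le> w \<and> w \<le> v then 1 else 0) * g (Y \<omega> w) \<partial>lborel)" for \<omega> v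
  have pd_eq: "path_defect F g (X \<omega>) v = pd \<omega> v" if "0 \<le> v" for \<omega> v
    using that unfolding path_defect_def pd_def X_def Y_def set_lebesgue_integral_def
    by (auto simp: step_path_def intro!: Bochner_Integration.integral_cong split: split_indicator)
  have W: "0 \<le> W" using order_trans[OF abs_ge_zero drift_error] .
  have V: "0 \<le> V"
  proof -
    interpret K: prob_space "P x" by (rule markov_kernel[OF chain])
    have f: "(\<lambda>z. F ((1 / r) *\<^sub>R z)) \<in> borel_measurable borel" by measurable
    have f2: "(\<lambda>z. (F ((1 / r) *\<^sub>R z))\<^sup>2) \<in> borel_measurable borel" by measurable
    have "integrable (P x) (\<lambda>z. F ((1 / r) *\<^sub>R z))"
      by (rule abs_kernel_integral_le(1)[OF chain f]) (rule F_bound)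
    moreover have "integrable (P x) (\<lambda>z. (F ((1 / r) *\<^sub>R z))\<^sup>2)"
      by (rule abs_kernel_integral_le(1)[OF chain f2, where C = "M\<^sup>2"])
         (use power_mono[OF F_bound abs_ge_zero, where n = 2] in simp)
    ultimately show ?thesis
      using K.variance_positive[of "\<lambda>z. F ((1 / r) *\<^sub>R z)"] var[of x] by (simp add: K.variance_eq)
  qed
  define b where "b = sqrt (T * c * V) + T * c * W + M / c"
  have M: "0 \<le> M" using order_trans[OF abs_ge_zero F_bound] .
  have b: "0 \<le> b" using T c V W M by (simp add: b_def)
  \<comment> \<open>Joint measurability holds because time enters only through a countably valued
    index.\<close>
  have meas_Y [measurable]: "(\<lambda>p. Y (fst p) (snd p)) \<in> borel_measurable (Pr x \<Otimes>\<^sub>M lborel)"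
    unfolding Y_def
    by (intro borel_measurable_scaleR borel_measurable_const
        measurable_compose_countable[where f = "\<lambda>k p. \<Phi> k (fst p)" and g = "\<lambda>p. nat \<lfloor>snd p * c\<rfloor>"]) measurable
  have meas_Y' [measurable]: "(\<lambda>\<omega>. Y \<omega> v) \<in> borel_measurable (Pr x)" for v
    unfolding Y_def by measurable
  have "(\<lambda>p. \<integral>w. (if 0 \<le> w \<and> w \<le> snd p then 1 else 0) * g (Y (fst p) w) \<partial>lborel) \<in> borel_measurable (Pr x \<Otimes>\<^sub>M lborel)"
  proof (rule lborel.borel_measurable_lebesgue_integral)
    have [measurable]: "(\<lambda>q. Y (fst (fst q)) (snd q)) \<in> borel_measurable ((Pr x \<Otimes>\<^sub>M lborel) \<Otimes>\<^sub>M lborel)"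
    proof -
      have "(\<lambda>q. (fst (fst q), snd q)) \<in> (Pr x \<Otimes>\<^sub>M lborel) \<Otimes>\<^sub>M (lborel :: real measure) \<rightarrow>\<^sub>M Pr x \<Otimes>\<^sub>M lborel"
        by measurable
      from measurable_compose[OF this meas_Y] show ?thesis by simp
    qed
    show "(\<lambda>(p, w). (if 0 \<le> w \<and> w \<le> snd p then 1 else 0) * g (Y (fst p) w))
        \<in> borel_measurable ((Pr x \<Otimes>\<^sub>M lborel) \<Otimes>\<^sub>M lborel)"
      unfolding split_beta by measurable
  qed
  then have [measurable]: "(\<lambda>p. pd (fst p) (snd p)) \<in> borel_measurable (Pr x \<Otimes>\<^sub>M lborel)"
    unfolding pd_def by measurable
  have cadlag [measurable]: "X \<omega> \<in> borel_measurable borel" for \<omega>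
    unfolding X_def by (intro borel_measurable_cadlag step_path_cadlag c)
  have fixed_time: "(\<integral>\<^sup>+\<omega>. ennreal \<bar>pd \<omega> v\<bar> \<partial>Pr x) \<le> ennreal b" if v: "0 \<le> v" "v \<le> T" for v
  proof -
    define n where "n = nat \<lfloor>v * c\<rfloor>"
    have n: "real n \<le> T * c"
    proof -
      have "real n \<le> v * c" unfolding n_def using v c by simp
      also have "\<dots> \<le> T * c" using v c by simp
      finally show ?thesis .
    qed
    let ?d = "\<lambda>\<omega>. F ((1 / r) *\<^sub>R \<Phi> n \<omega>) - F ((1 / r) *\<^sub>R \<Phi> 0 \<omega>) - (\<Sum>k<n. g ((1 / r) *\<^sub>R \<Phi> k \<omega>)) / c"
    have pd_le: "\<bar>pd \<omega> v\<bar> \<le> \<bar>?d \<omega>\<bar> + M / c" for \<omega>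
    proof -
      have "\<bar>(LINT w:{0..v}|lborel. g ((1 / r) *\<^sub>R \<Phi> (nat \<lfloor>w * c\<rfloor>) \<omega>)) - (\<Sum>k<n. g ((1 / r) *\<^sub>R \<Phi> k \<omega>)) / c\<bar> \<le> M / c"
        unfolding n_def by (rule step_function_integral_error[OF c g_bound v(1)])
      moreover have "(LINT w:{0..v}|lborel. g ((1 / r) *\<^sub>R \<Phi> (nat \<lfloor>w * c\<rfloor>) \<omega>))
          = (\<integral>w. (if 0 \<le> w \<and> w \<le> v then 1 else 0) * g (Y \<omega> w) \<partial>lborel)"
        unfolding set_lebesgue_integral_def Y_def
        by (intro Bochner_Integration.integral_cong) (auto split: split_indicator)
      ultimately show ?thesis by (simp add: pd_def Y_def n_def)
    qed
    have d_int: "integrable (Pr x) (\<lambda>\<omega>. \<bar>?d \<omega>\<bar>)"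
      using F_bound g_bound
      by (intro integrable_abs Bochner_Integration.integrable_diff integrable_divide
          Bochner_Integration.integrable_sum Px.integrable_const_bound[where B = M]) auto
    have "(\<integral>\<^sup>+\<omega>. ennreal \<bar>pd \<omega> v\<bar> \<partial>Pr x) \<le> (\<integral>\<^sup>+\<omega>. ennreal (\<bar>?d \<omega>\<bar> + M / c) \<partial>Pr x)"
      by (intro nn_integral_mono ennreal_leI pd_le)
    also have "\<dots> = ennreal (\<integral>\<omega>. \<bar>?d \<omega>\<bar> + M / c \<partial>Pr x)"
      using d_int M c by (intro nn_integral_eq_integral) auto
    also have "(\<integral>\<omega>. \<bar>?d \<omega>\<bar> + M / c \<partial>Pr x) = (\<integral>\<omega>. \<bar>?d \<omega>\<bar> \<partial>Pr x) + M / c"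
      using d_int by (simp add: Px.prob_space)
    also have "\<dots> \<le> (sqrt (n * V) + n * W) + M / c"
      by (intro add_right_mono expected_discrete_defect_le)
    also have "\<dots> \<le> b"
      unfolding b_def using n V W by (intro add_mono real_sqrt_le_mono mult_right_mono) auto
    finally show ?thesis by (simp add: ennreal_leI)
  qed
  have "(\<integral>\<^sup>+\<omega>. ennreal (total_defect F g T (X \<omega>)) \<partial>Pr x)
      = (\<integral>\<^sup>+\<omega>. (\<integral>\<^sup>+v. ennreal (indicator {0..T} v * \<bar>pd \<omega> v\<bar>) \<partial>lborel) \<partial>Pr x)"
  proof (rule nn_integral_cong)
    fix \<omega>
    have int: "integrable lborel (\<lambda>v. indicator {0..T} v *\<^sub>R \<bar>path_defect F g (X \<omega>) v\<bar>)"
      using set_integrable_path_defect[OF F_cont g_cont F_bound g_bound cadlag] by (simp add: set_integrable_def)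
    have "ennreal (total_defect F g T (X \<omega>)) = (\<integral>\<^sup>+v. ennreal (indicator {0..T} v *\<^sub>R \<bar>path_defect F g (X \<omega>) v\<bar>) \<partial>lborel)"
      unfolding total_defect_def set_lebesgue_integral_def by (rule nn_integral_eq_integral[OF int, symmetric]) simp
    also have "\<dots> = (\<integral>\<^sup>+v. ennreal (indicator {0..T} v * \<bar>pd \<omega> v\<bar>) \<partial>lborel)"
      by (rule nn_integral_cong) (auto simp: pd_eq split: split_indicator)
    finally show "ennreal (total_defect F g T (X \<omega>)) = (\<integral>\<^sup>+v. ennreal (indicator {0..T} v * \<bar>pd \<omega> v\<bar>) \<partial>lborel)" .
  qed
  also have "\<dots> = (\<integral>\<^sup>+v. (\<integral>\<^sup>+\<omega>. ennreal (indicator {0..T} v * \<bar>pd \<omega> v\<bar>) \<partial>Pr x) \<partial>lborel)"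
    by (rule Fubini'[symmetric]) (unfold split_beta, measurable)
  also have "\<dots> \<le> (\<integral>\<^sup>+v. ennreal b * indicator {0..T} v \<partial>lborel)"
    by (rule nn_integral_mono) (auto intro: fixed_time split: split_indicator)
  also have "\<dots> = ennreal (b * T)"
    using T b by (simp add: nn_integral_cmult ennreal_mult)
  finally show ?thesis
    unfolding X_def b_def[symmetric] using T b by (intro integral_real_bounded) auto
qed

end

section \<open>Vanishing of the expected defect\<close>

text \<open>(B3) applies to the compact ball. As 0 lies outside it, the factor
  \<open>norm a powr \<beta>\<close> can be divided out at bounded cost; off the ball both terms are
  zero, so the estimate is uniform over the whole space.\<close>

lemma scaled_drift_converges:
  fixes c :: "'a::euclidean_space"
  assumes B3: "cond_B3 Pr \<Phi> \<beta> \<O> \<Delta>" and \<rho>: "0 < \<rho>" "cball c \<rho> \<subseteq> \<O>" and e: "0 < e"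
  shows "\<forall>\<^sub>F r in at_top. \<forall>a. \<bar>bump_grad c \<rho> a \<bullet> (r powr \<beta> *\<^sub>R drift Pr \<Phi> (r *\<^sub>R a))
           - bump_drift (fluid_field \<beta> \<Delta>) c \<rho> a\<bar> \<le> e"
proof -
  have zero: "0 \<notin> cball c \<rho>" using B3 \<rho>(2) unfolding cond_B3_def by blast
  have "compact ((\<lambda>a. norm a powr (- \<beta>)) ` cball c \<rho>)"
    using zero by (intro compact_continuous_image continuous_intros) auto
  then have "bounded ((\<lambda>a. norm a powr (- \<beta>)) ` cball c \<rho>)" by (rule compact_imp_bounded)
  then obtain m where m: "0 < m" "\<And>a. a \<in> cball c \<rho> \<Longrightarrow> norm a powr (- \<beta>) \<le> m"
    unfolding bounded_pos by auto
  \<comment> \<open>The denominator is the bound of the gradient times the bound of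
    \<open>norm a powr (- \<beta>)\<close>.\<close>
  define e' where "e' = e / (4 * \<rho> ^ 3 * m)"
  have e': "0 < e'" using e m \<rho> by (simp add: e'_def)
  define dev where "dev r a = (r powr \<beta> * norm a powr \<beta>) *\<^sub>R drift Pr \<Phi> (r *\<^sub>R a) - \<Delta> a" for r a
  have "((\<lambda>r. \<Squnion>a\<in>cball c \<rho>. ennreal (norm (dev r a))) \<longlongrightarrow> 0) at_top"
    using B3 \<rho>(2) by (simp add: cond_B3_def dev_def)
  then have "\<forall>\<^sub>F r in at_top. (\<Squnion>a\<in>cball c \<rho>. ennreal (norm (dev r a))) < ennreal e'"
    by (rule order_tendstoD) (use e' in simp)
  then show ?thesis
  proof eventually_elim
    case (elim r)
    show ?case
    proof
      fix a
      show "\<bar>bump_grad c \<rho> a \<bullet> (r powr \<beta> *\<^sub>R drift Pr \<Phi> (r *\<^sub>R a)) - bump_drift (fluid_field \<beta> \<Delta>) c \<rho> a\<bar> \<le> e"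
      proof (cases "a \<in> cball c \<rho>")
        case True
        then have "ennreal (norm (dev r a)) \<le> (\<Squnion>a\<in>cball c \<rho>. ennreal (norm (dev r a)))"
          by (rule SUP_upper)
        also note elim
        finally have dev: "norm (dev r a) \<le> e'" by (simp add: ennreal_less_iff)
        have a0: "a \<noteq> 0" using True zero by blast
        then have "norm a powr (- \<beta>) *\<^sub>R dev r a = r powr \<beta> *\<^sub>R drift Pr \<Phi> (r *\<^sub>R a) - fluid_field \<beta> \<Delta> a"
          by (simp add: dev_def fluid_field_def scaleR_diff_right powr_minus)
        then have "bump_grad c \<rho> a \<bullet> (r powr \<beta> *\<^sub>R drift Pr \<Phi> (r *\<^sub>R a)) - bump_drift (fluid_field \<beta> \<Delta>) c \<rho> a
            = bump_grad c \<rho> a \<bullet> (norm a powr (- \<beta>) *\<^sub>R dev r a)"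
          by (simp add: bump_drift_def inner_diff_right)
        also have "\<bar>\<dots>\<bar> \<le> norm (bump_grad c \<rho> a) * (norm a powr (- \<beta>) * norm (dev r a))"
          by (rule order_trans[OF Cauchy_Schwarz_ineq2]) simp
        also have "\<dots> \<le> 4 * \<rho> ^ 3 * (m * e')"
          using True m e' \<rho> dev by (intro mult_mono norm_bump_grad_le) auto
        also have "\<dots> = e" using m \<rho> by (simp add: e'_def)
        finally show ?thesis .
      next
        case False
        then show ?thesis
          using e \<rho> by (simp add: bump_drift_def bump_outside dist_norm norm_minus_commute)
      qed
    qed
  qed
qed

text \<open>About \<open>T * r powr (1 + \<beta>)\<close> steps, each with variance and remainder of
  order \<open>r powr (- q)\<close>, contribute a vanishing power of \<open>r\<close> since
  \<open>1 + \<beta> < q\<close>. The drift error left by (B3) sums to at most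
  \<open>T * e'\<close>.\<close>

lemma expected_defect_vanishes:
  fixes c :: "'a::euclidean_space" and Pr :: "'a \<Rightarrow> 'w measure"
  assumes chain: "markov_chain P \<Omega> Pr \<Phi>"
    and integrable: "\<And>y. integrable (Pr y) (\<Phi> 1)"
    and B1: "cond_B1 Pr \<Phi> p"
    and B2: "cond_B2 Pr \<Phi> p \<beta>"
    and B3: "cond_B3 Pr \<Phi> \<beta> \<O> \<Delta>"
    and \<rho>: "0 < \<rho>" "cball c \<rho> \<subseteq> \<O>" and T: "0 \<le> T" and e: "0 < e"
  shows "\<forall>\<^sub>F r in at_top. \<forall>x.
    (\<integral>\<omega>. total_defect (bump c \<rho>) (bump_drift (fluid_field \<beta> \<Delta>) c \<rho>) T (scaled_path \<Phi> \<beta> r \<omega>) \<partial>Pr x) \<le> e"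
proof -
  let ?h = "fluid_field \<beta> \<Delta>"
  have h: "continuous_on \<O> ?h" "open \<O>"
    using B3 by (auto simp: cond_B3_def intro!: continuous_on_fluid_field)
  \<comment> \<open>Moments exist up to order \<open>p\<close>, and the bump estimates hold up to
    order 2; \<open>\<beta> < min 1 (p - 1)\<close> says exactly that
    \<open>1 + \<beta> < q\<close>.\<close>
  define q where "q = min p 2"
  have q: "1 \<le> q" "q \<le> 2" "0 < q" "q \<le> p" "1 + \<beta> < q" and \<beta>: "0 \<le> \<beta>"
    using B1 B2 by (auto simp: q_def cond_B1_def cond_B2_def)
  obtain M0 where M0: "0 < M0" "\<And>y. \<bar>bump c \<rho> y\<bar> \<le> M0"
    "\<And>a b. \<bar>bump c \<rho> b - bump c \<rho> a - bump_grad c \<rho> a \<bullet> (b - a)\<bar> \<le> M0 * norm (b - a) powr q"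
    "\<And>a b. (bump c \<rho> b - bump c \<rho> a)\<^sup>2 \<le> M0 * norm (b - a) powr q"
    using bump_estimates[OF \<rho>(1) q(1,2), of c] by metis
  obtain B where B: "\<And>y. \<bar>bump_drift ?h c \<rho> y\<bar> \<le> B"
    using bump_drift_bounded[OF \<rho>(1) h \<rho>(2)] by metis
  define M where "M = max M0 B"
  have f_bound: "\<bar>bump c \<rho> y\<bar> \<le> M" and g_bound: "\<bar>bump_drift ?h c \<rho> y\<bar> \<le> M" for y
    using M0(2)[of y] B[of y] by (auto simp: M_def)
  obtain C where C: "0 \<le> C" "\<And>y. integrable (P y) (\<lambda>z. norm (z - y) powr q)"
    "\<And>y. (\<integral>z. norm (z - y) powr q \<partial>P y) \<le> C"
    using kernel_moment[OF chain integrable B1 B2 q(3,4)] by metis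
  \<comment> \<open>The bound tends to \<open>T * T * e'\<close>, which must be below
    \<open>e\<close>; the summand 1 keeps the divisor positive when \<open>T = 0\<close>.\<close>
  define k where "k = T * T + 1"
  have k: "0 < k" by (simp add: k_def add_nonneg_pos)
  define e' where "e' = e / (2 * k)"
  have e': "0 < e'" using e k by (simp add: e'_def)
  define bound where "bound r = (sqrt (T * (M0 * C) * r powr (1 + \<beta> - q)) + (T * (M0 * C) * r powr (1 + \<beta> - q) + T * e')
      + M * r powr (- (1 + \<beta>))) * T" for r
  have "(bound \<longlongrightarrow> (sqrt (T * (M0 * C) * 0) + (T * (M0 * C) * 0 + T * e') + M * 0) * T) at_top"
    unfolding bound_def
    using q \<beta> by (intro tendsto_intros tendsto_neg_powr filterlim_ident) auto
  moreover have "(sqrt (T * (M0 * C) * 0) + (T * (M0 * C) * 0 + T * e') + M * 0) * T < e"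
  proof -
    have "k * e' = e / 2" using k by (simp add: e'_def)
    then have "T * T * e' < e" using e e' by (simp add: k_def distrib_right)
    then show ?thesis by (simp add: ac_simps)
  qed
  ultimately have "\<forall>\<^sub>F r in at_top. bound r < e" by (rule order_tendstoD)
  moreover note eventually_gt_at_top[of 0] scaled_drift_converges[OF B3 \<rho> e']
  ultimately show ?thesis
  proof eventually_elim
    case (elim r)
    define \<gamma> where "\<gamma> = r powr (1 + \<beta>)"
    have \<gamma>: "0 < \<gamma>" using elim by (simp add: \<gamma>_def)
    define V where "V = M0 * C * r powr (- q)"
    define W where "W = V + e' / \<gamma>"
    have F: "bump c \<rho> \<in> borel_measurable borel"
      by (intro borel_measurable_continuous_onI continuous_on_bump)
    note one = one_step_estimates[OF chain integrable F M0(2) M0(3) M0(4) C(2) C(3) elim(2)]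
    have drift_error: "\<bar>(\<integral>z. bump c \<rho> ((1 / r) *\<^sub>R z) \<partial>P y) - bump c \<rho> ((1 / r) *\<^sub>R y)
        - bump_drift ?h c \<rho> ((1 / r) *\<^sub>R y) / \<gamma>\<bar> \<le> W" for y
    proof -
      define a where "a = (1 / r) *\<^sub>R y"
      have y: "r *\<^sub>R a = y" using elim by (simp add: a_def)
      \<comment> \<open>Time scale against space scale: a drift of order
        \<open>r powr (- \<beta>)\<close>, shrunk by \<open>r\<close>, is one time step
        \<open>1 / \<gamma>\<close> of a field of order 1.\<close>
      have "r powr \<beta> / \<gamma> = 1 / r"
        using elim by (simp add: \<gamma>_def powr_add)
      then have "bump_grad c \<rho> a \<bullet> drift Pr \<Phi> y / r = (bump_grad c \<rho> a \<bullet> (r powr \<beta> *\<^sub>R drift Pr \<Phi> (r *\<^sub>R a))) / \<gamma>"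
        unfolding y by (simp add: divide_inverse mult.assoc[symmetric] mult.commute)
      then have "\<bar>bump_grad c \<rho> a \<bullet> drift Pr \<Phi> y / r - bump_drift ?h c \<rho> a / \<gamma>\<bar>
          = \<bar>bump_grad c \<rho> a \<bullet> (r powr \<beta> *\<^sub>R drift Pr \<Phi> (r *\<^sub>R a)) - bump_drift ?h c \<rho> a\<bar> / \<gamma>"
        using \<gamma> by (simp flip: diff_divide_distrib)
      also have "\<dots> \<le> e' / \<gamma>" using elim(3) \<gamma> by (intro divide_right_mono) auto
      finally show ?thesis
        using one(2)[of y] unfolding W_def V_def a_def by linarith
    qed
    show ?case
    proof
      fix x
      have "(\<integral>\<omega>. total_defect (bump c \<rho>) (bump_drift ?h c \<rho>) T (scaled_path \<Phi> \<beta> r \<omega>) \<partial>Pr x)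
          \<le> (sqrt (T * \<gamma> * V) + T * \<gamma> * W + M / \<gamma>) * T"
        unfolding scaled_path_eq_step_path \<gamma>_def[symmetric]
        by (rule expected_total_defect_le[OF chain continuous_on_bump continuous_on_bump_drift[OF \<rho>(1) h \<rho>(2)]
              f_bound g_bound elim(2) \<gamma> one(1)[folded V_def] drift_error T])
      also have "\<dots> = bound r"
      proof -
        have "\<gamma> * r powr (- q) = r powr (1 + \<beta> - q)" unfolding \<gamma>_def by (simp flip: powr_add)
        then have V: "T * \<gamma> * V = T * (M0 * C) * r powr (1 + \<beta> - q)"
          by (simp add: V_def mult.assoc mult.left_commute[of \<gamma>])
        have "T * \<gamma> * W = T * \<gamma> * V + T * e'" using \<gamma> by (simp add: W_def distrib_left)
        moreover have "M / \<gamma> = M * r powr (- (1 + \<beta>))"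
          by (simp only: \<gamma>_def powr_minus divide_inverse)
        ultimately show ?thesis unfolding bound_def V by simp
      qed
      also have "\<dots> \<le> e" using elim by simp
      finally show "(\<integral>\<omega>. total_defect (bump c \<rho>) (bump_drift ?h c \<rho>) T (scaled_path \<Phi> \<beta> r \<omega>) \<partial>Pr x) \<le> e" .
    qed
  qed
qed

section \<open>Passage to the fluid limit\<close>

text \<open>The functional is bounded and continuous, so weak convergence carries its vanishing
  expectation to \<open>Q\<close>; being nonnegative, it is then almost surely zero.\<close>

lemma fluid_limit_defect_zero:
  fixes c :: "'a::euclidean_space" and Pr :: "'a \<Rightarrow> 'w measure"
  assumes chain: "markov_chain P \<Omega> Pr \<Phi>"
    and integrable: "\<And>y. integrable (Pr y) (\<Phi> 1)"
    and B1: "cond_B1 Pr \<Phi> p"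
    and B2: "cond_B2 Pr \<Phi> p \<beta>"
    and B3: "cond_B3 Pr \<Phi> \<beta> \<O> \<Delta>"
    and limit: "fluid_limit Pr \<Phi> \<beta> x Q"
    and \<rho>: "0 < \<rho>" "cball c \<rho> \<subseteq> \<O>" and T: "0 \<le> T"
  shows "AE \<eta> in Q. total_defect (bump c \<rho>) (bump_drift (fluid_field \<beta> \<Delta>) c \<rho>) T \<eta> = 0"
proof -
  let ?h = "fluid_field \<beta> \<Delta>"
  let ?J = "total_defect (bump c \<rho>) (bump_drift ?h c \<rho>) T"
  have h: "continuous_on \<O> ?h" "open \<O>"
    using B3 by (auto simp: cond_B3_def intro!: continuous_on_fluid_field)
  obtain r y where r: "\<And>n. 0 < r n" "filterlim r at_top sequentially"
    and weak: "weakly_converges skorokhod_topology (\<lambda>n. scaled_law Pr \<Phi> \<beta> (r n) (y n)) Q"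
    and Q: "prob_space Q" "sets Q = sets (borel_of_topology skorokhod_topology)"
    using limit unfolding fluid_limit_def by blast
  interpret Q: prob_space Q by (rule Q)
  have space_Q: "space Q = cadlag_paths"
    using sets_eq_imp_space_eq[OF Q(2)] by (simp add: space_borel_of_topology topspace_skorokhod_topology)
  obtain B0 where B0: "\<And>y. \<bar>bump_drift ?h c \<rho> y\<bar> \<le> B0"
    using bump_drift_bounded[OF \<rho>(1) h \<rho>(2)] by metis
  define B where "B = max (\<rho> ^ 4) B0"
  have fB: "\<bar>bump c \<rho> y\<bar> \<le> B" and gB: "\<bar>bump_drift ?h c \<rho> y\<bar> \<le> B" for y
    using abs_bump_le[OF \<rho>(1), of c y] B0[of y] by (auto simp: B_def)
  note fg = continuous_on_bump[of UNIV c \<rho>] continuous_on_bump_drift[OF \<rho>(1) h \<rho>(2)] fB gB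
  have cont: "continuous_map skorokhod_topology euclideanreal ?J"
    by (rule continuous_map_total_defect[OF fg])
  have nonneg: "0 \<le> ?J \<eta>" for \<eta> by (rule total_defect_nonneg[OF fg])
  have le: "?J \<eta> \<le> (2 * B + B * T) * T" if "\<eta> \<in> cadlag_paths" for \<eta>
    by (rule total_defect_le[OF fg borel_measurable_cadlag[OF that] T])
  have "bounded (?J ` topspace skorokhod_topology)"
    unfolding bounded_iff topspace_skorokhod_topology using nonneg le by auto
  with weak cont have lim: "(\<lambda>n. \<integral>\<eta>. ?J \<eta> \<partial>scaled_law Pr \<Phi> \<beta> (r n) (y n)) \<longlonglongrightarrow> (\<integral>\<eta>. ?J \<eta> \<partial>Q)"
    unfolding weakly_converges_def by blast
  have J_meas: "?J \<in> borel_measurable (borel_of_topology skorokhod_topology)"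
    by (rule continuous_map_borel_measurable[OF cont])
  then have J_meas_Q: "?J \<in> borel_measurable Q"
    using measurable_cong_sets[OF Q(2) refl] by blast
  have law: "(\<integral>\<eta>. ?J \<eta> \<partial>scaled_law Pr \<Phi> \<beta> (r n) (y n))
      = (\<integral>\<omega>. ?J (scaled_path \<Phi> \<beta> (r n) \<omega>) \<partial>Pr (r n *\<^sub>R y n))" for n
    unfolding scaled_law_def
  proof (rule integral_distr[OF _ J_meas])
    show "scaled_path \<Phi> \<beta> (r n) \<in> Pr (r n *\<^sub>R y n) \<rightarrow>\<^sub>M borel_of_topology skorokhod_topology"
      unfolding scaled_path_eq_step_path[abs_def] using r(1)[of n]
      by (intro measurable_step_path measurable_chain[OF chain]) simp
  qed
  have "(\<integral>\<eta>. ?J \<eta> \<partial>Q) \<le> e" if e: "0 < e" for e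
  proof (rule tendsto_upperbound[OF lim])
    \<comment> \<open>Uniformity in the starting point matters, since the chain starts from
      \<open>r n *\<^sub>R y n\<close>, which varies with \<open>n\<close>.\<close>
    have "\<forall>\<^sub>F n in sequentially. \<forall>x. (\<integral>\<omega>. ?J (scaled_path \<Phi> \<beta> (r n) \<omega>) \<partial>Pr x) \<le> e"
      using expected_defect_vanishes[OF chain integrable B1 B2 B3 \<rho> T e] r(2)
      by (rule eventually_compose_filterlim)
    then show "\<forall>\<^sub>F n in sequentially. (\<integral>\<eta>. ?J \<eta> \<partial>scaled_law Pr \<Phi> \<beta> (r n) (y n)) \<le> e"
      by eventually_elim (simp add: law)
  qed simp
  then have "(\<integral>\<eta>. ?J \<eta> \<partial>Q) \<le> 0" by (rule field_le_epsilon[of _ 0, simplified])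
  moreover have "0 \<le> (\<integral>\<eta>. ?J \<eta> \<partial>Q)" using nonneg by simp
  ultimately have "(\<integral>\<eta>. ?J \<eta> \<partial>Q) = 0" by simp
  moreover have "integrable Q ?J"
    using nonneg le J_meas_Q
    by (intro Q.integrable_const_bound[where B = "(2 * B + B * T) * T"]) (auto simp: space_Q)
  ultimately show ?thesis
    using integral_nonneg_eq_0_iff_AE[of Q ?J] nonneg by simp
qed

section \<open>The integral equation along almost every path\<close>

theorem proposition1p5:
  fixes P :: "'a::euclidean_space \<Rightarrow> 'a measure"
    and \<Omega> :: "'w measure"
    and Pr :: "'a \<Rightarrow> 'w measure"
    and \<Phi> :: "nat \<Rightarrow> 'w \<Rightarrow> 'a"
    and p \<beta> s t :: real
    and \<O> :: "'a set"
    and \<Delta>\<^sub>i\<^sub>n\<^sub>f :: "'a \<Rightarrow> 'a"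
    and x :: 'a
    and Q :: "(real \<Rightarrow> 'a) measure"
  assumes chain: "markov_chain P \<Omega> Pr \<Phi>"
    and integrable: "\<And>y. integrable (Pr y) (\<Phi> 1)"
    and B1: "cond_B1 Pr \<Phi> p"
    and B2: "cond_B2 Pr \<Phi> p \<beta>"
    and B3: "cond_B3 Pr \<Phi> \<beta> \<O> \<Delta>\<^sub>i\<^sub>n\<^sub>f"
    and st: "0 \<le> s" "s \<le> t"
    and limit: "fluid_limit Pr \<Phi> \<beta> x Q"
  shows "AE \<eta> in Q. \<eta> \<in> paths_in \<O> s t \<longrightarrow>
           (\<Squnion>u\<in>{s..t}. ennreal (norm
              (\<eta> u - \<eta> s - integral {s..u} (\<lambda>v. fluid_field \<beta> \<Delta>\<^sub>i\<^sub>n\<^sub>f (\<eta> v))))) = 0"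
proof -
  let ?h = "fluid_field \<beta> \<Delta>\<^sub>i\<^sub>n\<^sub>f"
  have h: "continuous_on \<O> ?h" "open \<O>"
    using B3 by (auto simp: cond_B3_def intro!: continuous_on_fluid_field)
  obtain D :: "'a set" where D: "countable D" "\<And>U. open U \<Longrightarrow> U \<noteq> {} \<Longrightarrow> \<exists>d\<in>D. d \<in> U"
    using countable_dense_setE by metis
  define I where "I = D \<times> (\<rat> :: real set) \<times> (Basis :: 'a set) \<times> (\<rat> :: real set)"
  have I: "countable I"
    unfolding I_def by (intro countable_SIGMA countable_rat D(1) countable_finite[OF finite_Basis])
  \<comment> \<open>Countability of the centres, radii and horizons gives one null set for all test
    functions; the argument is deterministic from here on.\<close>
  have "AE \<eta> in Q. \<forall>(d, q, b, \<rho>)\<in>I. \<forall>n::nat. 0 < \<rho> \<longrightarrow> cball (d + q *\<^sub>R b) \<rho> \<subseteq> \<O> \<longrightarrow>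
      total_defect (bump (d + q *\<^sub>R b) \<rho>) (bump_drift ?h (d + q *\<^sub>R b) \<rho>) n \<eta> = 0"
    unfolding AE_ball_countable[OF I]
    by (auto simp: AE_all_countable intro!: fluid_limit_defect_zero[OF chain integrable B1 B2 B3 limit])
  then show ?thesis
  proof (eventually_elim, intro impI)
    fix \<eta>
    assume zero: "\<forall>(d, q, b, \<rho>)\<in>I. \<forall>n::nat. 0 < \<rho> \<longrightarrow> cball (d + q *\<^sub>R b) \<rho> \<subseteq> \<O> \<longrightarrow>
      total_defect (bump (d + q *\<^sub>R b) \<rho>) (bump_drift ?h (d + q *\<^sub>R b) \<rho>) n \<eta> = 0"
      and \<eta>: "\<eta> \<in> paths_in \<O> s t"
    have path: "\<eta> \<in> continuous_paths" "continuous_on {0..} \<eta>"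
      using \<eta> by (auto simp: paths_in_def continuous_paths_def)
    have ode: "((\<lambda>v. ?h (\<eta> v)) has_integral (\<eta> u - \<eta> s)) {s..u}" if u: "u \<in> {s..t}" for u
    proof (rule fluid_ode[OF h path(2) st(1) _ _ D(2)])
      show "\<eta> v \<in> \<O>" if "v \<in> {s..u}" for v
        using \<eta> u that by (auto simp: paths_in_def)
      fix d b c :: 'a and q \<rho> v :: real
      assume *: "d \<in> D" "q \<in> \<rat>" "b \<in> Basis" "\<rho> \<in> \<rat>" "0 < \<rho>" "c = d + q *\<^sub>R b" "cball c \<rho> \<subseteq> \<O>" "0 \<le> v"
      obtain B where B: "\<And>y. \<bar>bump_drift ?h c \<rho> y\<bar> \<le> B"
        using bump_drift_bounded[OF *(5) h *(7)] by metis
      show "((\<lambda>w. bump_drift ?h c \<rho> (\<eta> w)) has_integral (bump c \<rho> (\<eta> v) - bump c \<rho> (\<eta> 0))) {0..v}"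
      proof (rule total_defect_zeroD[OF continuous_on_bump continuous_on_bump_drift[OF *(5) h *(7)] _ _ _ path(1) *(8)])
        show "\<bar>bump c \<rho> y\<bar> \<le> max (\<rho> ^ 4) B" "\<bar>bump_drift ?h c \<rho> y\<bar> \<le> max (\<rho> ^ 4) B" for y
          using abs_bump_le[OF *(5), of c y] B[of y] by auto
        show "total_defect (bump c \<rho>) (bump_drift ?h c \<rho>) (real n) \<eta> = 0" for n
          using zero * by (auto simp: I_def)
      qed
    qed (use u in auto)
    have "\<eta> u - \<eta> s - integral {s..u} (\<lambda>v. ?h (\<eta> v)) = 0" if "u \<in> {s..t}" for u
      by (simp add: integral_unique[OF ode[OF that]])
    then show "(\<Squnion>u\<in>{s..t}. ennreal (norm (\<eta> u - \<eta> s - integral {s..u} (\<lambda>v. ?h (\<eta> v))))) = 0"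
      using st by simp
  qed
qed

end
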